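(* Let $\mathcal{E}^2$ be a classical consumption-loan overlapping generations economy with fiat money (as described in the context). Suppose that: $\mathcal{E}^2$ has bounded intraperiod growth rates with constants $0<\alpha_{\min}<\alpha_{\max}$; for every $j\ge0$, all households in $\bigcup_{t=0}^jG_t$ are indirectly resource related to one another; $\mathcal{E}^2$ satisfies the generalized Cass criterion; the economy $\mathcal{E}^2_{\ge1}$ formed by the generations born in $t\ge1$ has unbounded aggregate demand at border prices with constants $\sigma_t\in(0,1)$, $t\ge1$, is prone to savings, and satisfies $\inf_{t\ge1}\sigma_t>0$ and $\sup_{t\ge1}L_t<\infty$; and there is $\lambda>0$ such that, for all $p_1\in\mathbb{R}^{L_1}_{++}$, $$\min_{1\le i\le L_1}p_{1i}<\lambda\implies\sum_{h\in G_0}\Vert x^h_1(1,p_1)\Vert>\beta\sum_{h\in G_0}\Vert e^h_1\Vert .$$ Then there exists a Pareto optimal monetary equilibrium of $\mathcal{E}^2$.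
   Context: Notation: $\Vert c\Vert=\sum_i|c_i|$; $\mathbb{R}_+^n$, $\mathbb{R}_{++}^n$ are the vectors with non-negative, resp. strictly positive, coordinates; $p_t=(p_{t1},\ldots,p_{tL_t})\in\mathbb{R}^{L_t}$. Vectors indexed by the commodities of some periods are regarded as vectors over all commodities, with $0$ in the remaining coordinates. Economy $\mathcal{E}^2$: commodity periods are $t=1,2,\ldots$, with $L_t\ge1$ perishable commodities in period $t$. $G_t$ ($t\ge0$) is the (finite, non-empty) generation of households born in period $t$. A household $h\in G_t$, $t\ge1$, lives in periods $t,t+1$ and has consumption set $\mathbb{R}^{L_t+L_{t+1}}_+$, a nonzero endowment $e^h=(e^h_t,e^h_{t+1})\in\mathbb{R}^{L_t+L_{t+1}}_+$ and a utility $u^h:\mathbb{R}^{L_t+L_{t+1}}_+\to\mathbb{R}$. A household $h\in G_0$ is modelled only in period $1$: it has a utility $u^h:\mathbb{R}^{L_1}_+\to\mathbb{R}$, a nonzero endowment $e^h=e^h_1\in\mathbb{R}^{L_1}_+$ and an amount of fiat money $m^h\ge0$, with $\sum_{h\in G_0}m^h=1$. All utilities are continuous, non-decreasing, without local maxima and semi-strictly quasiconcave (i.e. $u(\tilde c)\ge u(c)$ implies $u(\alpha\tilde c+(1-\alpha)c)\ge u(c)$ for $0\le\alpha\le1$, and $u(\tilde c)>u(c)$ implies $u(\alpha\tilde c+(1-\alpha)c)>u(c)$ for $0<\alpha\le1$). Every commodity of every period $t\ge1$ has strictly positive aggregate endowment: $\sum_{t\ge0}\sum_{h\in G_t}e^h\in\mathbb{R}^\infty_{++}$.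 Demand (assumed single-valued): for $h\in G_t$, $t\ge1$, $x^h(p_t,p_{t+1})=(x^h_t,x^h_{t+1})(p_t,p_{t+1})$ maximizes $u^h(c)$ over $c\in\mathbb{R}^{L_t+L_{t+1}}_+$ with $(p_t,p_{t+1})\cdot(c-e^h)\le0$, for $(p_t,p_{t+1})\in\mathbb{R}^{L_t+L_{t+1}}_{++}$. For $h\in G_0$, $x^h_1(p_m,p_1)$ maximizes $u^h(c)$ over $c\in\mathbb{R}^{L_1}_+$ with $p_1\cdot(c-e^h_1)\le p_mm^h$, for $(p_m,p_1)\in\mathbb{R}_+\times\mathbb{R}^{L_1}_{++}$. Equilibrium of $\mathcal{E}^2$: $(p_m,p)$ with $p_m\ge0$ and $p=(p_1,p_2,\ldots)\in\mathbb{R}^\infty_{++}$ such that $\sum_{h\in G_0}x^h_1(p_m,p_1)+\sum_{h\in G_1}x^h_1(p_1,p_2)=\sum_{h\in G_0}e^h_1+\sum_{h\in G_1}e^h_1$ and $\sum_{h\in G_{t-1}}x^h_t(p_{t-1},p_t)+\sum_{h\in G_t}x^h_t(p_t,p_{t+1})=\sum_{h\in G_{t-1}}e^h_t+\sum_{h\in G_t}e^h_t$ for $t\ge2$. It is monetary if $p_m>0$. It is Pareto optimal if there is no family $\{y^h\}$ of non-negative consumption bundles ($y^h\in\mathbb{R}^{L_1}_+$ for $h\in G_0$, $y^h\in\mathbb{R}^{L_t+L_{t+1}}_+$ for $h\in G_t$, $t\ge1$) with the same aggregate as the equilibrium allocation in every period, giving every household at least its equilibrium utility and some household strictly more. Bounded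 intraperiod growth rates: $\sum_{h\in G_{t+1}}\Vert e^h_{t+1}\Vert/\sum_{h\in G_t}\Vert e^h_{t+1}\Vert\in(\alpha_{\min},\alpha_{\max})$ for all $t\ge0$. Put $\beta=\max\{1+\alpha_{\min}^{-1},1+\alpha_{\max}\}$. Resource relatedness: fix $j\ge0$. $h'\in\bigcup_{t=0}^jG_t$ is resource related to $h''\in\bigcup_{t=0}^jG_t$ if for every family of non-negative consumption bundles $\{c^h\}_{h\in\bigcup_{t=0}^jG_t}$ with $\sum_hc^h\le\sum_he^h$ (sums over $\bigcup_{t=0}^jG_t$) there are another such family $\{\tilde c^h\}$ and $y\ge0$ (over the commodities of periods $1,\ldots,j+1$) such that $\sum_h\tilde c^h\le\sum_he^h+y$, $u^h(\tilde c^h)\ge u^h(c^h)$ for all $h$, $u^{h''}(\tilde c^{h''})>u^{h''}(c^{h''})$, and $y_{ti}>0$ only if $e^{h'}_{ti}>0$. $h'$ is indirectly resource related to $h''$ if there is a finite chain $h_0=h',\ldots,h_n=h''$, $n\ge1$, in $\bigcup_{t=0}^jG_t$ with each $h_m$ resource related to $h_{m+1}$. Generalized Cass criterion (an assumption on $\mathcal{E}^2$): an equilibrium $(p_m,p)$ of $\mathcal{E}^2$ is Pareto optimal if and only if $\sum_{t=1}^\infty\frac{1}{\Vert p_t\Vert\sum_{h\in G_t}\Vert e^h_t\Vert}=+\infty$. Unbounded aggregate demand at border prices for $\mathcal{E}^2_{\ge1}$: with $\mathcal{B}_t(\sigma)=\{p\in\mathbb{R}^{L_t+L_{t+1}}_{++}\mid\sigma\le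 p_i\le\sigma^{-1}\ \forall i\}$, for all $t\ge1$ there is $\sigma_t\in(0,1)$ (fixed from now on) such that for all $(p_t,p_{t+1})\in\mathbb{R}^{L_t+L_{t+1}}_{++}$, if $(p_t/p_{t1},p_{t+1}/p_{t1})\notin\mathcal{B}_t(\sigma_t)$ then $\sum_{h\in G_t}\Vert x^h(p_t,p_{t+1})\Vert>\beta\sum_{h\in G_t}\Vert e^h\Vert$. $\mathcal{E}^2_{\ge1}$ is prone to savings: with $s^h(p_t,p_{t+1})=\frac{p_t}{\Vert p_t\Vert}\cdot(e^h_t-x^h_t(p_t,p_{t+1}))$ for $h\in G_t$, there are $\varepsilon,\delta>0$ such that for all $t\ge1$ and $(p_t,p_{t+1})\in\mathbb{R}^{L_t+L_{t+1}}_{++}$ with $(p_t/p_{t1},p_{t+1}/p_{t1})\in\mathcal{B}_t(\sigma_t)$, $$\frac{\sum_{h\in G_t}s^h(p_t,p_{t+1})}{\sum_{h\in G_t}\Vert e^h_t\Vert}\le\delta\implies\frac{\Vert p_t\Vert}{\Vert p_{t+1}\Vert}\le\frac{1}{1+\varepsilon}\,\frac{\sum_{h\in G_{t+1}}\Vert e^h_{t+1}\Vert}{\sum_{h\in G_t}\Vert e^h_t\Vert}.$$ *)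

theory Defs
  imports "HOL-Analysis.Analysis"
begin

text \<open>
  Bundles and prices are functions \<open>c s i\<close> of a period \<open>s \<ge> 1\<close> and a commodity \<open>i \<in> {1..L s}\<close>.
  A bundle over the commodities of some periods is extended by \<open>0\<close>. On bundles vanishing
  outside a fixed finite set of commodities the product topology of the function type is the
  Euclidean one, and the order of the function type is the coordinatewise one.
\<close>

type_synonym commodity_vector = "nat \<Rightarrow> nat \<Rightarrow> real"

record 'h olg =
  gen :: "nat \<Rightarrow> 'h set"
  num_goods :: "nat \<Rightarrow> nat"
  endow :: "'h \<Rightarrow> commodity_vector"
  util :: "'h \<Rightarrow> commodity_vector \<Rightarrow> real"
  money :: "'h \<Rightarrow> real"

text \<open>Generation \<open>0\<close> is modelled in period \<open>1\<close> only.\<close>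

definition lifespan :: "nat \<Rightarrow> nat set" where
  "lifespan t = (if t = 0 then {1} else {t, t + 1})"

definition goods :: "'h olg \<Rightarrow> nat \<Rightarrow> nat set" where
  "goods E s = {1..num_goods E s}"

definition cons_set :: "'h olg \<Rightarrow> nat \<Rightarrow> commodity_vector set" where
  "cons_set E t = {c. (\<forall>s i. 0 \<le> c s i) \<and> (\<forall>s i. c s i \<noteq> 0 \<longrightarrow> s \<in> lifespan t \<and> i \<in> goods E s)}"

text \<open>\<open>norm_at E s c\<close> is the norm of the period-\<open>s\<close> part of \<open>c\<close>, and \<open>norm_life E t c\<close> the norm
  of a bundle \<open>c\<close> of a household born in period \<open>t\<close>.\<close>

definition norm_at :: "'h olg \<Rightarrow> nat \<Rightarrow> commodity_vector \<Rightarrow> real" where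
  "norm_at E s c = (\<Sum>i\<in>goods E s. \<bar>c s i\<bar>)"

definition norm_life :: "'h olg \<Rightarrow> nat \<Rightarrow> commodity_vector \<Rightarrow> real" where
  "norm_life E t c = (\<Sum>s\<in>lifespan t. norm_at E s c)"

definition positive_prices :: "'h olg \<Rightarrow> nat set \<Rightarrow> commodity_vector \<Rightarrow> bool" where
  "positive_prices E T p \<longleftrightarrow> (\<forall>s\<in>T. \<forall>i\<in>goods E s. 0 < p s i)"

text \<open>Only the coordinates of \<open>p\<close> in the periods in which the household lives matter here.\<close>

definition budget_old :: "'h olg \<Rightarrow> 'h \<Rightarrow> real \<Rightarrow> commodity_vector \<Rightarrow> commodity_vector set" where
  "budget_old E h pm p =
     {c \<in> cons_set E 0. (\<Sum>i\<in>goods E 1. p 1 i * (c 1 i - endow E h 1 i)) \<le> pm * money E h}"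

definition budget :: "'h olg \<Rightarrow> nat \<Rightarrow> 'h \<Rightarrow> commodity_vector \<Rightarrow> commodity_vector set" where
  "budget E t h p =
     {c \<in> cons_set E t. (\<Sum>s\<in>{t, t + 1}. \<Sum>i\<in>goods E s. p s i * (c s i - endow E h s i)) \<le> 0}"

definition demand_old :: "'h olg \<Rightarrow> 'h \<Rightarrow> real \<Rightarrow> commodity_vector \<Rightarrow> commodity_vector" where
  "demand_old E h pm p = arg_max (util E h) (\<lambda>c. c \<in> budget_old E h pm p)"

definition demand :: "'h olg \<Rightarrow> nat \<Rightarrow> 'h \<Rightarrow> commodity_vector \<Rightarrow> commodity_vector" where
  "demand E t h p = arg_max (util E h) (\<lambda>c. c \<in> budget E t h p)"

definition single_valued_demand :: "'h olg \<Rightarrow> bool" where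
  "single_valued_demand E \<longleftrightarrow>
     (\<forall>h\<in>gen E 0. \<forall>pm p. 0 \<le> pm \<and> positive_prices E {1} p \<longrightarrow>
        (\<exists>!c. is_arg_max (util E h) (\<lambda>c. c \<in> budget_old E h pm p) c)) \<and>
     (\<forall>t\<ge>1. \<forall>h\<in>gen E t. \<forall>p. positive_prices E {t, t + 1} p \<longrightarrow>
        (\<exists>!c. is_arg_max (util E h) (\<lambda>c. c \<in> budget E t h p) c))"

definition no_local_max_on :: "commodity_vector set \<Rightarrow> (commodity_vector \<Rightarrow> real) \<Rightarrow> bool" where
  "no_local_max_on X u \<longleftrightarrow> (\<forall>c\<in>X. \<forall>U. open U \<and> c \<in> U \<longrightarrow> (\<exists>c'\<in>U \<inter> X. u c < u c'))"

definition mix :: "real \<Rightarrow> commodity_vector \<Rightarrow> commodity_vector \<Rightarrow> commodity_vector" where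
  "mix a c' c = (\<lambda>s i. a * c' s i + (1 - a) * c s i)"

definition semistrict_quasiconcave_on :: "commodity_vector set \<Rightarrow> (commodity_vector \<Rightarrow> real) \<Rightarrow> bool" where
  "semistrict_quasiconcave_on X u \<longleftrightarrow>
     (\<forall>c\<in>X. \<forall>c'\<in>X.
        (u c' \<ge> u c \<longrightarrow> (\<forall>a. 0 \<le> a \<and> a \<le> 1 \<longrightarrow> u (mix a c' c) \<ge> u c)) \<and>
        (u c' > u c \<longrightarrow> (\<forall>a. 0 < a \<and> a \<le> 1 \<longrightarrow> u (mix a c' c) > u c)))"

text \<open>The aggregate in period \<open>t \<ge> 1\<close> only involves the generations \<open>t - 1\<close> and \<open>t\<close>.\<close>

definition aggregate :: "'h olg \<Rightarrow> ('h \<Rightarrow> commodity_vector) \<Rightarrow> nat \<Rightarrow> nat \<Rightarrow> real" where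
  "aggregate E c t i = (\<Sum>h\<in>gen E (t - 1). c h t i) + (\<Sum>h\<in>gen E t. c h t i)"

definition olg_economy :: "'h olg \<Rightarrow> bool" where
  "olg_economy E \<longleftrightarrow>
     (\<forall>t\<ge>1. 1 \<le> num_goods E t) \<and>
     (\<forall>t. finite (gen E t) \<and> gen E t \<noteq> {}) \<and>
     disjoint_family (gen E) \<and>
     (\<forall>t. \<forall>h\<in>gen E t.
        endow E h \<in> cons_set E t \<and> endow E h \<noteq> (\<lambda>s i. 0) \<and>
        continuous_on (cons_set E t) (util E h) \<and>
        mono_on (cons_set E t) (util E h) \<and>
        no_local_max_on (cons_set E t) (util E h) \<and>
        semistrict_quasiconcave_on (cons_set E t) (util E h)) \<and>
     (\<forall>h\<in>gen E 0. 0 \<le> money E h) \<and> (\<Sum>h\<in>gen E 0. money E h) = 1 \<and>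
     (\<forall>t\<ge>1. \<forall>i\<in>goods E t. 0 < aggregate E (endow E) t i) \<and>
     single_valued_demand E"

text \<open>Since generations are disjoint, a household determines its period of birth.\<close>

definition allocation :: "'h olg \<Rightarrow> real \<Rightarrow> commodity_vector \<Rightarrow> 'h \<Rightarrow> commodity_vector" where
  "allocation E pm p h =
     (if h \<in> gen E 0 then demand_old E h pm p else demand E (THE t. h \<in> gen E t) h p)"

definition equilibrium :: "'h olg \<Rightarrow> real \<Rightarrow> commodity_vector \<Rightarrow> bool" where
  "equilibrium E pm p \<longleftrightarrow>
     0 \<le> pm \<and> positive_prices E {1..} p \<and>
     (\<forall>t\<ge>1. \<forall>i\<in>goods E t. aggregate E (allocation E pm p) t i = aggregate E (endow E) t i)"

definition monetary :: "real \<Rightarrow> commodity_vector \<Rightarrow> bool" where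
  "monetary pm p \<longleftrightarrow> pm > 0"

definition pareto_optimal :: "'h olg \<Rightarrow> real \<Rightarrow> commodity_vector \<Rightarrow> bool" where
  "pareto_optimal E pm p \<longleftrightarrow>
     \<not> (\<exists>y. (\<forall>t. \<forall>h\<in>gen E t. y h \<in> cons_set E t) \<and>
            (\<forall>t\<ge>1. \<forall>i\<in>goods E t. aggregate E y t i = aggregate E (allocation E pm p) t i) \<and>
            (\<forall>t. \<forall>h\<in>gen E t. util E h (y h) \<ge> util E h (allocation E pm p h)) \<and>
            (\<exists>t. \<exists>h\<in>gen E t. util E h (y h) > util E h (allocation E pm p h)))"

definition bounded_intraperiod_growth :: "'h olg \<Rightarrow> real \<Rightarrow> real \<Rightarrow> bool" where
  "bounded_intraperiod_growth E amin amax \<longleftrightarrow>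
     (\<forall>t. (\<Sum>h\<in>gen E (t + 1). norm_at E (t + 1) (endow E h)) /
          (\<Sum>h\<in>gen E t. norm_at E (t + 1) (endow E h)) \<in> {amin<..<amax})"

definition born_upto :: "'h olg \<Rightarrow> nat \<Rightarrow> 'h set" where
  "born_upto E j = (\<Union>t\<le>j. gen E t)"

definition consumption_family_upto :: "'h olg \<Rightarrow> nat \<Rightarrow> ('h \<Rightarrow> commodity_vector) \<Rightarrow> bool" where
  "consumption_family_upto E j c \<longleftrightarrow> (\<forall>t\<le>j. \<forall>h\<in>gen E t. c h \<in> cons_set E t)"

definition resource_related :: "'h olg \<Rightarrow> nat \<Rightarrow> 'h \<Rightarrow> 'h \<Rightarrow> bool" where
  "resource_related E j h' h'' \<longleftrightarrow>
     h' \<in> born_upto E j \<and> h'' \<in> born_upto E j \<and>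
     (\<forall>c. consumption_family_upto E j c \<and>
          (\<forall>s\<in>{1..j+1}. \<forall>i\<in>goods E s.
             (\<Sum>h\<in>born_upto E j. c h s i) \<le> (\<Sum>h\<in>born_upto E j. endow E h s i)) \<longrightarrow>
        (\<exists>c' y. consumption_family_upto E j c' \<and>
           (\<forall>s\<in>{1..j+1}. \<forall>i\<in>goods E s.
              0 \<le> y s i \<and>
              (\<Sum>h\<in>born_upto E j. c' h s i) \<le> (\<Sum>h\<in>born_upto E j. endow E h s i) + y s i \<and>
              (y s i > 0 \<longrightarrow> endow E h' s i > 0)) \<and>
           (\<forall>h\<in>born_upto E j. util E h (c' h) \<ge> util E h (c h)) \<and>
           util E h'' (c' h'') > util E h'' (c h'')))"

definition indirectly_resource_related :: "'h olg \<Rightarrow> nat \<Rightarrow> 'h \<Rightarrow> 'h \<Rightarrow> bool" where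
  "indirectly_resource_related E j = (resource_related E j)\<^sup>+\<^sup>+"

definition generalized_cass_criterion :: "'h olg \<Rightarrow> bool" where
  "generalized_cass_criterion E \<longleftrightarrow>
     (\<forall>pm p. equilibrium E pm p \<longrightarrow>
        (pareto_optimal E pm p \<longleftrightarrow>
         filterlim (\<lambda>n. \<Sum>t=1..n. 1 / (norm_at E t p * (\<Sum>h\<in>gen E t. norm_at E t (endow E h))))
           at_top sequentially))"

definition price_box :: "'h olg \<Rightarrow> nat \<Rightarrow> real \<Rightarrow> commodity_vector set" where
  "price_box E t \<sigma> =
     {p. positive_prices E {t, t + 1} p \<and>
         (\<forall>s\<in>{t, t + 1}. \<forall>i\<in>goods E s. \<sigma> \<le> p s i \<and> p s i \<le> inverse \<sigma>)}"

definition normalize_prices :: "nat \<Rightarrow> commodity_vector \<Rightarrow> commodity_vector" where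
  "normalize_prices t p = (\<lambda>s i. p s i / p t 1)"

definition unbounded_demand_at_border :: "'h olg \<Rightarrow> real \<Rightarrow> (nat \<Rightarrow> real) \<Rightarrow> bool" where
  "unbounded_demand_at_border E \<beta> \<sigma> \<longleftrightarrow>
     (\<forall>t\<ge>1. \<sigma> t \<in> {0<..<1} \<and>
        (\<forall>p. positive_prices E {t, t + 1} p \<and> normalize_prices t p \<notin> price_box E t (\<sigma> t) \<longrightarrow>
           (\<Sum>h\<in>gen E t. norm_life E t (demand E t h p)) >
           \<beta> * (\<Sum>h\<in>gen E t. norm_life E t (endow E h))))"

definition savings :: "'h olg \<Rightarrow> nat \<Rightarrow> 'h \<Rightarrow> commodity_vector \<Rightarrow> real" where
  "savings E t h p =
     (\<Sum>i\<in>goods E t. p t i / norm_at E t p * (endow E h t i - demand E t h p t i))"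

definition prone_to_savings :: "'h olg \<Rightarrow> (nat \<Rightarrow> real) \<Rightarrow> bool" where
  "prone_to_savings E \<sigma> \<longleftrightarrow>
     (\<exists>\<epsilon>>0. \<exists>\<delta>>0. \<forall>t\<ge>1. \<forall>p.
        positive_prices E {t, t + 1} p \<and> normalize_prices t p \<in> price_box E t (\<sigma> t) \<longrightarrow>
        (\<Sum>h\<in>gen E t. savings E t h p) / (\<Sum>h\<in>gen E t. norm_at E t (endow E h)) \<le> \<delta> \<longrightarrow>
        norm_at E t p / norm_at E (t + 1) p \<le>
          1 / (1 + \<epsilon>) * ((\<Sum>h\<in>gen E (t + 1). norm_at E (t + 1) (endow E h)) /
                         (\<Sum>h\<in>gen E t. norm_at E t (endow E h))))"

end

theory Submission
  imports Defs
begin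

text \<open>
  For each \<open>j\<close> truncate the economy after generation \<open>j\<close> and redeem money, in period \<open>j + 1\<close>, by
  the bundle consisting of \<open>\<mu>\<close> times the endowment norm of the young of that period, in every
  commodity. Solving the complementarity problem for excess demand on a cube of prices, Walras' law
  bounds all excess demands, so the border condition confines relative prices and the solution is
  an equilibrium. With the price of money set to \<open>1\<close>, the savings rate of generation \<open>t\<close> is
  \<open>1 / (\<parallel>p\<^sub>t\<parallel> \<Sum>\<parallel>e\<^sup>h\<^sub>t\<parallel>)\<close> and equals \<open>\<mu>\<close> in period \<open>j + 1\<close>. Proneness to savings makes a
  savings rate below \<open>\<mu>\<close> decrease further, hence all rates are at least \<open>\<mu>\<close>; this bounds prices
  above, while the condition on generation \<open>0\<close> bounds them below. A limit of these
  equilibria is monetary, and its Cass series has terms at least \<open>\<mu>\<close>.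
\<close>

section \<open>Complementarity on a cube\<close>

text \<open>Demand is defined at strictly positive prices only, which rules out a fixed-point
  argument on a closed simplex. Prices are confined to \<open>[\<eta>, 1]\<close> instead, and both
  artificial bounds must prove harmless: for small \<eta> the border condition bounds the ratio of
  any two prices up to the horizon by a constant independent of \<eta>, so no price can sit at the
  floor while another sits at the cap. The border condition can be contradicted because the growth
  bounds keep the resources of two consecutive periods below \<beta> times the endowment of the
  generation living in them. The redemption bundle must not spoil this, which limits \<mu> by the
  number of commodities; proneness to savings limits it by \<delta>. Neither limit depends on
  \<open>j\<close>, so one \<mu> serves all truncations, and this uniformity prevents prices in
  units of money from diverging in the limit. The bundle contains all commodities in equal amounts
  so that its value is proportional to the norm of the price vector: the last savings rate is then
  known whatever the relative prices are.\<close>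

lemma tendsto_fun_iff:
  fixes X :: "nat \<Rightarrow> 'a \<Rightarrow> 'b::topological_space"
  shows "(X \<longlonglongrightarrow> x) \<longleftrightarrow> (\<forall>i. (\<lambda>n. X n i) \<longlonglongrightarrow> x i)"
proof -
  have "(X \<longlonglongrightarrow> x) \<longleftrightarrow> limitin (product_topology (\<lambda>_. euclidean) UNIV) X x sequentially"
    by (simp add: euclidean_product_topology)
  also have "\<dots> \<longleftrightarrow> (\<forall>i. (\<lambda>n. X n i) \<longlonglongrightarrow> x i)"
    by (subst limitin_componentwise) (simp add: extensional_def)
  finally show ?thesis .
qed

lemma compact_fun:
  fixes K :: "'a \<Rightarrow> 'b::topological_space set"
  assumes "\<And>i. compact (K i)"
  shows "compact {x. \<forall>i. x i \<in> K i}"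
proof -
  have "compactin (product_topology (\<lambda>_. euclidean) UNIV) (PiE UNIV K)"
    using assms by (subst compactin_PiE) simp
  moreover have "PiE UNIV K = {x. \<forall>i. x i \<in> K i}"
    by auto
  ultimately show ?thesis
    by (simp add: euclidean_product_topology)
qed

text \<open>Takes the place of a diagonal extraction: a product of compact intervals is compact, and
  countably many coordinates make the space metrizable, so compactness is sequential. It serves grid
  cells, demanded bundles and infinite price systems alike.\<close>

lemma bounded_vector_subsequence:
  fixes X :: "nat \<Rightarrow> nat \<Rightarrow> nat \<Rightarrow> real"
  assumes "\<And>n s i. X n s i \<in> {lo s i..hi s i}"
  obtains x r where "\<And>s i. x s i \<in> {lo s i..hi s i}" "strict_mono (r :: nat \<Rightarrow> nat)"
    "\<And>s i. (\<lambda>n. X (r n) s i) \<longlonglongrightarrow> x s i"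
proof -
  have "compact {x. \<forall>s. x s \<in> {y. \<forall>i. y i \<in> {lo s i..hi s i}}}"
    by (intro compact_fun) auto
  moreover have "\<forall>n. X n \<in> {x. \<forall>s. x s \<in> {y. \<forall>i. y i \<in> {lo s i..hi s i}}}"
    using assms by auto
  ultimately obtain x r where "x \<in> {x. \<forall>s. x s \<in> {y. \<forall>i. y i \<in> {lo s i..hi s i}}}"
    "strict_mono (r :: nat \<Rightarrow> nat)" "(X \<circ> r) \<longlonglongrightarrow> x"
    unfolding compact_eq_seq_compact_metric seq_compact_def by blast
  then show ?thesis
    by (intro that[of x r]) (auto simp: tendsto_fun_iff o_def)
qed

text \<open>Kuhn's lemma is applied directly to the signs of \<open>z\<close> on ever finer grids: the cube has a
  variable dimension, so Brouwer's theorem on a Euclidean space type is not applicable.\<close>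

lemma box_complementarity_nat:
  fixes z :: "(nat \<Rightarrow> real) \<Rightarrow> nat \<Rightarrow> real" and N :: nat
  assumes cont: "\<And>X x i. i < N \<Longrightarrow> (\<And>n i. i < N \<Longrightarrow> X n i \<in> {0..1}) \<Longrightarrow>
      (\<And>i. i < N \<Longrightarrow> x i \<in> {0..1}) \<Longrightarrow>
      (\<And>i. i < N \<Longrightarrow> (\<lambda>n. X n i) \<longlonglongrightarrow> x i) \<Longrightarrow> (\<lambda>n. z (X n) i) \<longlonglongrightarrow> z x i"
  obtains x where "\<And>i. i < N \<Longrightarrow> x i \<in> {0..1}"
    "\<And>i. i < N \<Longrightarrow> x i < 1 \<Longrightarrow> z x i \<le> 0" "\<And>i. i < N \<Longrightarrow> 0 < x i \<Longrightarrow> 0 \<le> z x i"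
proof -
  define g where "g m v = (\<lambda>i::nat. real (v i) / real (Suc m))" for m :: nat and v :: "nat \<Rightarrow> nat"
  \<comment> \<open>Label 0 records \<open>z \<ge> 0\<close> and label 1 records
    \<open>z < 0\<close>, except on the two faces where Kuhn's lemma prescribes the label. There it
    says nothing about the sign of \<open>z\<close>, which is why the conclusion exempts coordinates
    at 0 and at 1.\<close>
  define lab where "lab m v i = (if v i = 0 \<or> v i \<noteq> Suc m \<and> 0 \<le> z (g m v) i then 0 else (1::nat))"
    for m v i
  define nb where "nb q v \<longleftrightarrow> (\<forall>k<N. q k \<le> v k \<and> v k \<le> q k + 1)" for q v :: "nat \<Rightarrow> nat"
  have lab01: "lab m v i = 0 \<or> lab m v i = 1" for m v i
    by (simp add: lab_def)
  define good where "good m q \<longleftrightarrow> (\<forall>i<N. q i < Suc m) \<and>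
      (\<forall>i<N. \<exists>r s. nb q r \<and> nb q s \<and> lab m r i \<noteq> lab m s i)" for m q
  have "\<exists>q. good m q" for m
  proof -
    have label: "\<forall>x. (\<forall>i<N. x i \<le> Suc m) \<longrightarrow> (\<forall>i<N. lab m x i = 0 \<or> lab m x i = 1)"
      "\<forall>x. (\<forall>i<N. x i \<le> Suc m) \<longrightarrow> (\<forall>i<N. x i = 0 \<longrightarrow> lab m x i = 0)"
      "\<forall>x. (\<forall>i<N. x i \<le> Suc m) \<longrightarrow> (\<forall>i<N. x i = Suc m \<longrightarrow> lab m x i = 1)"
      by (simp_all add: lab_def)
    show ?thesis
      unfolding good_def nb_def by (rule kuhn_lemma[OF zero_less_Suc label]) (intro exI conjI)
  qed
  moreover define q where "q m = (SOME q. good m q)" for m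
  ultimately have good: "good m (q m)" for m
    by (simp add: someI_ex)
  then have q: "q m i < Suc m" if "i < N" for m i
    using good[of m, unfolded good_def, THEN conjunct1] that by blast
  \<comment> \<open>Two vertices of the same cell, chosen separately for each coordinate:
    \<open>r m i\<close> will yield \<open>0 \<le> z x i\<close> and \<open>s m i\<close> the
    opposite inequality.\<close>
  define r where "r m i = (SOME v. nb (q m) v \<and> lab m v i = 0)" for m i
  define s where "s m i = (SOME v. nb (q m) v \<and> lab m v i = 1)" for m i
  have rs: "(nb (q m) (r m i) \<and> lab m (r m i) i = 0) \<and> (nb (q m) (s m i) \<and> lab m (s m i) i = 1)"
    if "i < N" for m i
  proof -
    have "\<exists>v w. nb (q m) v \<and> nb (q m) w \<and> lab m v i \<noteq> lab m w i"
      using good[of m] that by (simp add: good_def)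
    then obtain v w where vw: "nb (q m) v" "nb (q m) w" "lab m v i \<noteq> lab m w i"
      by (elim exE conjE)
    have ex: "\<exists>v. nb (q m) v \<and> lab m v i = 0" "\<exists>v. nb (q m) v \<and> lab m v i = 1"
      using vw lab01[of m v i] lab01[of m w i] by auto
    show ?thesis
      unfolding r_def s_def using someI_ex[OF ex(1)] someI_ex[OF ex(2)] by (rule conjI)
  qed
  have r: "q m k \<le> r m i k \<and> r m i k \<le> q m k + 1"
    and s: "q m k \<le> s m i k \<and> s m i k \<le> q m k + 1" if "i < N" "k < N" for m i k
    using rs[OF that(1), of m] that(2) unfolding nb_def by blast+
  have lab: "lab m (r m i) i = 0 \<and> lab m (s m i) i = 1" if "i < N" for m i
    using rs[OF that] by blast
  \<comment> \<open>The index \<open>a\<close> is a dummy that gives the cell corners the doubly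
    indexed form of \<open>bounded_vector_subsequence\<close>.\<close>
  define X where "X m (a::nat) i = (if i < N then g m (q m) i else 0)" for m a i
  have X01: "X m a i \<in> {0..1}" for m a i
    using q[of i m] by (auto simp: X_def g_def divide_simps)
  obtain x \<rho> where x: "\<And>a i. x a i \<in> {0..1}" and \<rho>: "strict_mono \<rho>"
    and lim: "\<And>a i. (\<lambda>m. X (\<rho> m) a i) \<longlonglongrightarrow> x a i"
    using bounded_vector_subsequence[of X "\<lambda>_ _. 0" "\<lambda>_ _. 1"] X01 by metis
  have small: "(\<lambda>m. 1 / real (Suc (\<rho> m))) \<longlonglongrightarrow> 0"
    using LIMSEQ_subseq_LIMSEQ[OF LIMSEQ_inverse_real_of_nat \<rho>] by (simp add: o_def divide_inverse)
  \<comment> \<open>The corner and the corner plus the mesh width enclose the vertices of a cell, so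
    all choices of vertices share the limit of the corners.\<close>
  have near: "(\<lambda>m. g (\<rho> m) (v m) k) \<longlonglongrightarrow> x 0 k"
    if v: "\<And>m. q (\<rho> m) k \<le> v m k \<and> v m k \<le> q (\<rho> m) k + 1" and k: "k < N" for v k
  proof (rule tendsto_sandwich)
    show "\<forall>\<^sub>F m in sequentially. X (\<rho> m) 0 k \<le> g (\<rho> m) (v m) k"
      using v k by (auto simp: X_def g_def divide_right_mono)
    have "real (v m k) \<le> real (q (\<rho> m) k) + 1" for m using v[of m] by linarith
    then show "\<forall>\<^sub>F m in sequentially. g (\<rho> m) (v m) k \<le> X (\<rho> m) 0 k + 1 / real (Suc (\<rho> m))"
      using k by (intro always_eventually allI)
        (simp add: X_def g_def divide_right_mono flip: add_divide_distrib)
    show "(\<lambda>m. X (\<rho> m) 0 k) \<longlonglongrightarrow> x 0 k" by (rule lim)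
    show "(\<lambda>m. X (\<rho> m) 0 k + 1 / real (Suc (\<rho> m))) \<longlonglongrightarrow> x 0 k"
      using tendsto_add[OF lim small] by simp
  qed
  have in01: "g m v k \<in> {0..1}" if "q m k \<le> v k \<and> v k \<le> q m k + 1" "k < N" for m v k
    using that q[of k m] by (auto simp: g_def divide_simps)
  show ?thesis
  proof (rule that[of "x 0"])
    fix i assume i: "i < N"
    show "x 0 i \<in> {0..1}" by (rule x)
    {
      assume "x 0 i < 1"
      have "(\<lambda>m. g (\<rho> m) (s (\<rho> m) i) i) \<longlonglongrightarrow> x 0 i"
        using s[OF i i] by (intro near i) auto
      then have "\<forall>\<^sub>F m in sequentially. g (\<rho> m) (s (\<rho> m) i) i < 1"
        using \<open>x 0 i < 1\<close> by (rule order_tendstoD)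
      then have "\<forall>\<^sub>F m in sequentially. z (g (\<rho> m) (s (\<rho> m) i)) i \<le> 0"
      proof eventually_elim
        case (elim m)
        then have "s (\<rho> m) i i \<noteq> Suc (\<rho> m)" by (auto simp: g_def)
        then show ?case using lab[OF i, of "\<rho> m"] by (auto simp: lab_def split: if_splits)
      qed
      moreover have "(\<lambda>m. z (g (\<rho> m) (s (\<rho> m) i)) i) \<longlonglongrightarrow> z (x 0) i"
        using s[OF i] by (intro cont[OF i] in01 x near) auto
      ultimately show "z (x 0) i \<le> 0"
        by (intro tendsto_upperbound) auto
    }
    {
      assume "0 < x 0 i"
      have "(\<lambda>m. g (\<rho> m) (r (\<rho> m) i) i) \<longlonglongrightarrow> x 0 i"
        using r[OF i i] by (intro near i) auto
      then have "\<forall>\<^sub>F m in sequentially. 0 < g (\<rho> m) (r (\<rho> m) i) i"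
        using \<open>0 < x 0 i\<close> by (rule order_tendstoD)
      then have "\<forall>\<^sub>F m in sequentially. 0 \<le> z (g (\<rho> m) (r (\<rho> m) i)) i"
      proof eventually_elim
        case (elim m)
        then have "r (\<rho> m) i i \<noteq> 0" by (intro notI) (simp add: g_def)
        then show ?case using lab[OF i, of "\<rho> m"] by (auto simp: lab_def split: if_splits)
      qed
      moreover have "(\<lambda>m. z (g (\<rho> m) (r (\<rho> m) i)) i) \<longlonglongrightarrow> z (x 0) i"
        using r[OF i] by (intro cont[OF i] in01 x near) auto
      ultimately show "0 \<le> z (x 0) i"
        by (intro tendsto_lowerbound) auto
    }
  qed
qed

text \<open>Transports the unit cube to an arbitrary finite index set and interval. The indices will
  be pairs of a period and a commodity, and a lower end \<open>a > 0\<close> keeps prices where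
  demand is defined.\<close>

lemma box_complementarity:
  fixes z :: "('i \<Rightarrow> real) \<Rightarrow> 'i \<Rightarrow> real" and a b :: real
  assumes "finite I" and ab: "a < b"
    and cont: "\<And>X x i. i \<in> I \<Longrightarrow> (\<And>n i. i \<in> I \<Longrightarrow> X n i \<in> {a..b}) \<Longrightarrow>
      (\<And>i. i \<in> I \<Longrightarrow> x i \<in> {a..b}) \<Longrightarrow>
      (\<And>i. i \<in> I \<Longrightarrow> (\<lambda>n. X n i) \<longlonglongrightarrow> x i) \<Longrightarrow> (\<lambda>n. z (X n) i) \<longlonglongrightarrow> z x i"
  obtains x where "\<And>i. i \<in> I \<Longrightarrow> x i \<in> {a..b}"
    "\<And>i. i \<in> I \<Longrightarrow> x i < b \<Longrightarrow> z x i \<le> 0" "\<And>i. i \<in> I \<Longrightarrow> a < x i \<Longrightarrow> 0 \<le> z x i"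
proof -
  obtain f where f: "bij_betw f I {0..<card I}"
    using ex_bij_betw_finite_nat[OF \<open>finite I\<close>] by blast
  define f' where "f' = the_inv_into I f"
  have f': "f' k \<in> I" "f (f' k) = k" if "k < card I" for k
    using that f unfolding f'_def bij_betw_def by (auto intro: the_inv_into_into f_the_inv_into_f)
  have fI: "f i < card I" "f' (f i) = i" if "i \<in> I" for i
    using that f unfolding f'_def bij_betw_def by (auto simp: the_inv_into_f_f)
  define h where "h y = (\<lambda>i. a + (b - a) * y (f i))" for y
  have h01: "h y i \<in> {a..b}" if "i \<in> I" "\<And>k. k < card I \<Longrightarrow> y k \<in> {0..1}" for y i
  proof -
    have "y (f i) \<in> {0..1}" using that fI by blast
    then have "0 \<le> (b - a) * y (f i)" "(b - a) * y (f i) \<le> (b - a) * 1"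
      using ab by (intro mult_nonneg_nonneg mult_left_mono; auto)+
    then show ?thesis by (simp add: h_def)
  qed
  obtain y where y: "\<And>k. k < card I \<Longrightarrow> y k \<in> {0..1}"
    "\<And>k. k < card I \<Longrightarrow> y k < 1 \<Longrightarrow> z (h y) (f' k) \<le> 0"
    "\<And>k. k < card I \<Longrightarrow> 0 < y k \<Longrightarrow> 0 \<le> z (h y) (f' k)"
  proof (rule box_complementarity_nat)
    fix X :: "nat \<Rightarrow> nat \<Rightarrow> real" and x i
    assume i: "i < card I" and X: "\<And>n k. k < card I \<Longrightarrow> X n k \<in> {0..1}"
      and x: "\<And>k. k < card I \<Longrightarrow> x k \<in> {0..1}"
      and lim: "\<And>k. k < card I \<Longrightarrow> (\<lambda>n. X n k) \<longlonglongrightarrow> x k"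
    show "(\<lambda>n. z (h (X n)) (f' i)) \<longlonglongrightarrow> z (h x) (f' i)"
    proof (rule cont)
      show "f' i \<in> I" by (rule f'(1)[OF i])
      fix k n assume k: "k \<in> I"
      show "h (X n) k \<in> {a..b}" by (rule h01[OF k X])
      show "h x k \<in> {a..b}" by (rule h01[OF k x])
      show "(\<lambda>n. h (X n) k) \<longlonglongrightarrow> h x k"
        unfolding h_def by (intro tendsto_add tendsto_mult tendsto_const lim fI(1)[OF k])
    qed
  qed (rule that)
  show ?thesis
  proof (rule that[of "h y"])
    fix i assume i: "i \<in> I"
    show "h y i \<in> {a..b}" using h01 i y by blast
    have "h y i < b \<longleftrightarrow> (b - a) * y (f i) < (b - a) * 1" by (simp add: h_def) argo
    then have "h y i < b \<longleftrightarrow> y (f i) < 1" using ab by (simp del: mult_1_right)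
    then show "h y i < b \<Longrightarrow> z (h y) i \<le> 0" using y(2)[of "f i"] fI[OF i] by simp
    have "a < h y i \<longleftrightarrow> 0 < y (f i)" using ab by (simp add: h_def zero_less_mult_iff)
    then show "a < h y i \<Longrightarrow> 0 \<le> z (h y) i" using y(3)[of "f i"] fI[OF i] by simp
  qed
qed

section \<open>Household demand\<close>

definition expenditure :: "'h olg \<Rightarrow> nat \<Rightarrow> commodity_vector \<Rightarrow> commodity_vector \<Rightarrow> real" where
  "expenditure E t p c = (\<Sum>s\<in>lifespan t. \<Sum>i\<in>goods E s. p s i * c s i)"

text \<open>Merges the two kinds of budget, so that optimality and continuity of demand are proved
  once for all generations; for \<open>t \<ge> 1\<close> the price of money drops out.\<close>

definition wealth :: "'h olg \<Rightarrow> nat \<Rightarrow> 'h \<Rightarrow> real \<Rightarrow> commodity_vector \<Rightarrow> real" where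
  "wealth E t h pm p = (if t = 0 then pm * money E h else 0) + expenditure E t p (endow E h)"

definition affordable :: "'h olg \<Rightarrow> nat \<Rightarrow> 'h \<Rightarrow> real \<Rightarrow> commodity_vector \<Rightarrow> commodity_vector set" where
  "affordable E t h pm p = {c \<in> cons_set E t. expenditure E t p c \<le> wealth E t h pm p}"

lemma finite_lifespan [simp]: "finite (lifespan t)"
  by (simp add: lifespan_def)

lemma finite_goods [simp]: "finite (goods E s)"
  by (simp add: goods_def)

lemma budget_old_eq_affordable: "budget_old E h pm p = affordable E 0 h pm p"
proof (rule set_eqI)
  fix c
  have "(\<Sum>i\<in>goods E 1. p 1 i * (c 1 i - endow E h 1 i)) =
      expenditure E 0 p c - expenditure E 0 p (endow E h)"
    by (simp add: expenditure_def lifespan_def right_diff_distrib sum_subtractf)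
  then show "c \<in> budget_old E h pm p \<longleftrightarrow> c \<in> affordable E 0 h pm p"
    unfolding budget_old_def affordable_def wealth_def by auto
qed

lemma budget_eq_affordable:
  assumes "1 \<le> t"
  shows "budget E t h p = affordable E t h pm p"
proof (rule set_eqI)
  fix c
  have "(\<Sum>s\<in>{t, t + 1}. \<Sum>i\<in>goods E s. p s i * (c s i - endow E h s i)) =
      expenditure E t p c - expenditure E t p (endow E h)"
    using assms by (simp add: expenditure_def lifespan_def right_diff_distrib sum_subtractf)
  then show "c \<in> budget E t h p \<longleftrightarrow> c \<in> affordable E t h pm p"
    using assms unfolding budget_def affordable_def wealth_def by auto
qed

lemma tendsto_expenditure:
  assumes "\<And>s i. s \<in> lifespan t \<Longrightarrow> i \<in> goods E s \<Longrightarrow> (\<lambda>n. p n s i) \<longlonglongrightarrow> q s i"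
    and "\<And>s i. s \<in> lifespan t \<Longrightarrow> i \<in> goods E s \<Longrightarrow> (\<lambda>n. c n s i) \<longlonglongrightarrow> d s i"
  shows "(\<lambda>n. expenditure E t (p n) (c n)) \<longlonglongrightarrow> expenditure E t q d"
  unfolding expenditure_def by (intro tendsto_sum tendsto_mult assms)

lemma expenditure_scale: "expenditure E t p (\<lambda>s i. a * c s i) = a * expenditure E t p c"
  unfolding expenditure_def sum_distrib_left by (simp only: mult.left_commute)

lemma expenditure_le_imp_coordinate_le:
  assumes c: "c \<in> cons_set E t" and p: "\<And>s i. s \<in> lifespan t \<Longrightarrow> i \<in> goods E s \<Longrightarrow> 0 \<le> p s i"
    and le: "expenditure E t p c \<le> w" and si: "s \<in> lifespan t" "i \<in> goods E s"
  shows "p s i * c s i \<le> w"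
proof -
  have nn: "0 \<le> p s i * c s i" if "s \<in> lifespan t" "i \<in> goods E s" for s i
    using that c p by (simp add: cons_set_def)
  have "p s i * c s i \<le> (\<Sum>i\<in>goods E s. p s i * c s i)"
    using si nn by (intro member_le_sum) auto
  also have "\<dots> \<le> expenditure E t p c"
    unfolding expenditure_def using si nn by (intro member_le_sum sum_nonneg) auto
  finally show ?thesis using le by linarith
qed

lemma cons_set_scale: "c \<in> cons_set E t \<Longrightarrow> 0 \<le> a \<Longrightarrow> (\<lambda>s i. a * c s i) \<in> cons_set E t"
  by (auto simp: cons_set_def)

lemma cons_set_limit:
  assumes c: "\<And>n::nat. c n \<in> cons_set E t" and lim: "\<And>s i. (\<lambda>n. c n s i) \<longlonglongrightarrow> d s i"
  shows "d \<in> cons_set E t"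
proof -
  have "0 \<le> d s i" for s i
    using c by (intro LIMSEQ_le_const[OF lim]) (auto simp: cons_set_def)
  moreover have "d s i = 0" if "\<not> (s \<in> lifespan t \<and> i \<in> goods E s)" for s i
  proof -
    have "c n s i = 0" for n using c[of n] that by (auto simp: cons_set_def)
    then show ?thesis using lim[of s i] by (simp add: LIMSEQ_const_iff)
  qed
  ultimately show ?thesis by (auto simp: cons_set_def)
qed

section \<open>Optimality and continuity of individual demand\<close>

locale olg =
  fixes E :: "'h olg"
  assumes economy: "olg_economy E"
begin

lemma finite_gen [simp]: "finite (gen E t)"
  using economy unfolding olg_economy_def by blast

lemma num_goods_ge: "1 \<le> t \<Longrightarrow> 1 \<le> num_goods E t"
  using economy unfolding olg_economy_def by blast

lemma goods_nonempty: "1 \<le> t \<Longrightarrow> 1 \<in> goods E t"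
  using num_goods_ge by (simp add: goods_def)

lemma gen_unique:
  assumes "h \<in> gen E t" "h \<in> gen E t'"
  shows "t = t'"
proof -
  have "disjoint_family (gen E)"
    using economy unfolding olg_economy_def by blast
  then show ?thesis
    using assms unfolding disjoint_family_on_def by blast
qed

lemma household:
  assumes "h \<in> gen E t"
  shows endow_in_cons_set: "endow E h \<in> cons_set E t"
    and endow_nonzero: "endow E h \<noteq> (\<lambda>s i. 0)"
    and continuous_util: "continuous_on (cons_set E t) (util E h)"
    and no_local_max_util: "no_local_max_on (cons_set E t) (util E h)"
  using economy assms unfolding olg_economy_def by blast+

lemma money_nonneg: "h \<in> gen E 0 \<Longrightarrow> 0 \<le> money E h"
  using economy unfolding olg_economy_def by blast

lemma sum_money: "(\<Sum>h\<in>gen E 0. money E h) = 1"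
  using economy unfolding olg_economy_def by blast

lemma single_valued: "single_valued_demand E"
  using economy unfolding olg_economy_def by blast

lemma endow_nonneg: "h \<in> gen E t \<Longrightarrow> 0 \<le> endow E h s i"
  using endow_in_cons_set by (simp add: cons_set_def)

lemma util_limit:
  assumes h: "h \<in> gen E t" and c: "\<And>n::nat. c n \<in> cons_set E t" "d \<in> cons_set E t"
    and lim: "\<And>s i. (\<lambda>n. c n s i) \<longlonglongrightarrow> d s i"
  shows "(\<lambda>n. util E h (c n)) \<longlonglongrightarrow> util E h d"
proof (rule continuous_on_tendsto_compose[OF continuous_util[OF h]])
  show "c \<longlonglongrightarrow> d" using lim by (simp add: tendsto_fun_iff)
qed (use c in auto)

lemma allocation_eq_arg_max:
  assumes "h \<in> gen E t"
  shows "allocation E pm p h = arg_max (util E h) (\<lambda>c. c \<in> affordable E t h pm p)"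
proof (cases "t = 0")
  case True
  then show ?thesis
    using assms by (simp add: allocation_def demand_old_def budget_old_eq_affordable)
next
  case False
  then have "h \<notin> gen E 0" using assms gen_unique by blast
  moreover have "(THE t. h \<in> gen E t) = t"
    using assms gen_unique by (intro the_equality) auto
  ultimately show ?thesis
    using False by (simp add: allocation_def demand_def budget_eq_affordable[of t E h p pm])
qed

lemma allocation_young:
  assumes "h \<in> gen E t" "1 \<le> t"
  shows "allocation E pm p h = demand E t h p"
  unfolding allocation_eq_arg_max[OF assms(1)] demand_def budget_eq_affordable[OF assms(2), of E h p pm] ..

lemma allocation_old: "h \<in> gen E 0 \<Longrightarrow> allocation E pm p h = demand_old E h pm p"
  by (simp add: allocation_def)

lemma allocation_cong_affordable:
  assumes "h \<in> gen E t" "affordable E t h pm p = affordable E t h pm' p'"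
  shows "allocation E pm p h = allocation E pm' p' h"
  unfolding allocation_eq_arg_max[OF assms(1)] assms(2) ..

lemma allocation_cong:
  assumes "h \<in> gen E t" "\<And>s i. s \<in> lifespan t \<Longrightarrow> i \<in> goods E s \<Longrightarrow> p s i = p' s i"
  shows "allocation E pm p h = allocation E pm p' h"
proof -
  have "expenditure E t p c = expenditure E t p' c" for c
    unfolding expenditure_def using assms by (intro sum.cong) auto
  then show ?thesis
    by (intro allocation_cong_affordable[OF assms(1)]) (simp add: affordable_def wealth_def)
qed

lemma allocation_homogeneous:
  assumes "h \<in> gen E t" "0 < pm"
  shows "allocation E 1 (\<lambda>s i. p s i / pm) h = allocation E pm p h"
proof -
  have e: "expenditure E t (\<lambda>s i. p s i / pm) c = expenditure E t p c / pm" for c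
    by (simp add: expenditure_def sum_divide_distrib)
  have "wealth E t h 1 (\<lambda>s i. p s i / pm) = wealth E t h pm p / pm"
    using assms by (simp add: wealth_def e add_divide_distrib)
  then have "affordable E t h 1 (\<lambda>s i. p s i / pm) = affordable E t h pm p"
    using assms by (simp add: affordable_def e divide_le_cancel)
  then show ?thesis by (rule allocation_cong_affordable[OF assms(1)])
qed

lemma unique_optimum:
  assumes "h \<in> gen E t" "0 \<le> pm" "positive_prices E (lifespan t) p"
  shows "\<exists>!c. is_arg_max (util E h) (\<lambda>c. c \<in> affordable E t h pm p) c"
proof (cases "t = 0")
  case True
  then have "\<exists>!c. is_arg_max (util E h) (\<lambda>c. c \<in> budget_old E h pm p) c"
    using single_valued assms unfolding single_valued_demand_def
    by (simp add: lifespan_def)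
  then show ?thesis using True by (simp add: budget_old_eq_affordable)
next
  case False
  then have "\<exists>!c. is_arg_max (util E h) (\<lambda>c. c \<in> budget E t h p) c"
    using single_valued assms unfolding single_valued_demand_def
    by (simp add: lifespan_def)
  then show ?thesis using False by (simp add: budget_eq_affordable[of t E h p pm])
qed

lemma allocation_optimal:
  assumes "h \<in> gen E t" "0 \<le> pm" "positive_prices E (lifespan t) p"
  shows "is_arg_max (util E h) (\<lambda>c. c \<in> affordable E t h pm p) (allocation E pm p h)"
  unfolding allocation_eq_arg_max[OF assms(1)] arg_max_def
  by (rule someI_ex[OF ex1_implies_ex[OF unique_optimum[OF assms]]])

lemma allocation_affordable:
  assumes "h \<in> gen E t" "0 \<le> pm" "positive_prices E (lifespan t) p"
  shows "allocation E pm p h \<in> affordable E t h pm p"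
  using allocation_optimal[OF assms] by (simp add: is_arg_max_def)

lemma allocation_in_cons_set:
  assumes "h \<in> gen E t" "0 \<le> pm" "positive_prices E (lifespan t) p"
  shows "allocation E pm p h \<in> cons_set E t"
  using allocation_affordable[OF assms] by (simp add: affordable_def)

lemma allocation_nonneg:
  assumes "h \<in> gen E t" "0 \<le> pm" "positive_prices E (lifespan t) p"
  shows "0 \<le> allocation E pm p h s i"
  using allocation_in_cons_set[OF assms] by (simp add: cons_set_def)

text \<open>The bundles costing strictly less than the wealth form an open set. Were the demanded
  bundle among them, the absence of local maxima would give a better affordable one.\<close>

lemma budget_binding:
  assumes h: "h \<in> gen E t" and "0 \<le> pm" "positive_prices E (lifespan t) p"
  shows "expenditure E t p (allocation E pm p h) = wealth E t h pm p"
proof (rule ccontr)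
  let ?x = "allocation E pm p h"
  assume "expenditure E t p ?x \<noteq> wealth E t h pm p"
  then have lt: "expenditure E t p ?x < wealth E t h pm p"
    using allocation_affordable[OF assms] by (simp add: affordable_def)
  have "continuous_on UNIV (\<lambda>c::commodity_vector. c s i)" for s i
  proof -
    have "continuous_on UNIV (\<lambda>c::commodity_vector. c s)"
      by (rule continuous_on_product_coordinates)
    then show ?thesis by (rule continuous_on_product_then_coordinatewise)
  qed
  then have "continuous_on UNIV (expenditure E t p)"
    unfolding expenditure_def by (intro continuous_intros) auto
  then have "open {c. expenditure E t p c < wealth E t h pm p}"
    by (intro open_Collect_less continuous_on_const)
  moreover have "no_local_max_on (cons_set E t) (util E h)"
    by (rule no_local_max_util[OF h])
  ultimately obtain c where "c \<in> cons_set E t" "expenditure E t p c < wealth E t h pm p"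
    "util E h ?x < util E h c"
    using lt allocation_in_cons_set[OF assms] unfolding no_local_max_on_def by blast
  then show False
    using allocation_optimal[OF assms] by (auto simp: is_arg_max_def affordable_def)
qed

text \<open>Provides the cheaper point needed for continuity: shrinking an affordable bundle towards
  0 makes it cost strictly less than the wealth.\<close>

lemma wealth_pos:
  assumes h: "h \<in> gen E t" and pm: "0 \<le> pm" and p: "positive_prices E (lifespan t) p"
  shows "0 < wealth E t h pm p"
proof -
  have e: "endow E h \<in> cons_set E t" "endow E h \<noteq> (\<lambda>s i. 0)"
    using h by (rule endow_in_cons_set endow_nonzero)+
  then obtain s i where si: "endow E h s i \<noteq> 0" by (auto simp: fun_eq_iff)
  then have s: "s \<in> lifespan t" "i \<in> goods E s" and pos: "0 < endow E h s i"
    using e(1) by (auto simp: cons_set_def order_le_less)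
  have "p s i * endow E h s i \<le> expenditure E t p (endow E h)"
    using s e p by (intro expenditure_le_imp_coordinate_le) (auto simp: positive_prices_def order_less_imp_le)
  moreover have "0 < p s i * endow E h s i"
    using s p pos by (simp add: positive_prices_def)
  moreover have "0 \<le> (if t = 0 then pm * money E h else 0)"
    using h pm money_nonneg[of h] by (auto intro!: mult_nonneg_nonneg)
  ultimately show ?thesis by (simp add: wealth_def)
qed

text \<open>A competitor \<open>c\<close> of the limit, scaled by \<open>a < 1\<close>, is strictly
  inside the limit budget and hence affordable along the sequence from some index on; there it is no
  better than the optima. Passing to the limit and then letting \<open>a\<close> tend to 1 compares
  \<open>c\<close> itself with \<open>d\<close>.\<close>

lemma limit_of_optima_optimal:
  assumes h: "h \<in> gen E t" and pm: "\<And>n. 0 \<le> pm n" "0 \<le> qm"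
    and p: "\<And>n. positive_prices E (lifespan t) (p n)" "positive_prices E (lifespan t) q"
    and pmlim: "pm \<longlonglongrightarrow> qm"
    and plim: "\<And>s i. s \<in> lifespan t \<Longrightarrow> i \<in> goods E s \<Longrightarrow> (\<lambda>n. p n s i) \<longlonglongrightarrow> q s i"
    and xlim: "\<And>s i. (\<lambda>n. allocation E (pm n) (p n) h s i) \<longlonglongrightarrow> d s i"
  shows "d = allocation E qm q h"
proof -
  note xn = allocation_in_cons_set[OF h pm(1) p(1)]
  have d: "d \<in> cons_set E t"
    by (rule cons_set_limit[OF xn xlim])
  have wlim: "(\<lambda>n. wealth E t h (pm n) (p n)) \<longlonglongrightarrow> wealth E t h qm q"
    unfolding wealth_def by (intro tendsto_add tendsto_expenditure plim)
      (auto intro: tendsto_mult_right pmlim)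
  have "(\<lambda>n. expenditure E t (p n) (allocation E (pm n) (p n) h)) \<longlonglongrightarrow> expenditure E t q d"
    by (intro tendsto_expenditure plim xlim)
  then have "(\<lambda>n. wealth E t h (pm n) (p n)) \<longlonglongrightarrow> expenditure E t q d"
    by (simp add: budget_binding[OF h pm(1) p(1)])
  then have "expenditure E t q d = wealth E t h qm q"
    using wlim LIMSEQ_unique by blast
  then have aff: "d \<in> affordable E t h qm q" using d by (simp add: affordable_def)
  have scaled: "util E h (\<lambda>s i. a * c s i) \<le> util E h d"
    if c: "c \<in> affordable E t h qm q" and a: "0 \<le> a" "a < 1" for c a
  proof -
    let ?c = "\<lambda>s i. a * c s i"
    have cs: "?c \<in> cons_set E t" using c a by (intro cons_set_scale) (auto simp: affordable_def)
    have "expenditure E t q ?c \<le> a * wealth E t h qm q"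
      using c a by (simp add: expenditure_scale affordable_def mult_left_mono)
    also have "\<dots> < wealth E t h qm q" using a wealth_pos[OF h pm(2) p(2)] by simp
    finally have "expenditure E t q ?c < wealth E t h qm q" .
    then have "0 < wealth E t h qm q - expenditure E t q ?c" by simp
    moreover have "(\<lambda>n. wealth E t h (pm n) (p n) - expenditure E t (p n) ?c)
        \<longlonglongrightarrow> wealth E t h qm q - expenditure E t q ?c"
      by (intro tendsto_diff wlim tendsto_expenditure plim tendsto_const)
    ultimately have "\<forall>\<^sub>F n in sequentially. 0 < wealth E t h (pm n) (p n) - expenditure E t (p n) ?c"
      by (rule order_tendstoD(1)[rotated])
    then have "\<forall>\<^sub>F n in sequentially. util E h ?c \<le> util E h (allocation E (pm n) (p n) h)"
    proof eventually_elim
      case (elim n)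
      then have "?c \<in> affordable E t h (pm n) (p n)" using cs by (simp add: affordable_def)
      then show ?case
        using allocation_optimal[OF h pm(1) p(1), of n] by (force simp: is_arg_max_def)
    qed
    then show ?thesis
      by (intro tendsto_lowerbound[OF util_limit[OF h xn d xlim]]) auto
  qed
  have "util E h c \<le> util E h d" if c: "c \<in> affordable E t h qm q" for c
  proof (rule LIMSEQ_le_const2)
    let ?a = "\<lambda>n. 1 - 1 / real (Suc n)"
    have one: "?a \<longlonglongrightarrow> 1"
      using tendsto_diff[OF tendsto_const LIMSEQ_inverse_real_of_nat, of 1]
      by (simp add: inverse_eq_divide)
    have "(\<lambda>n. ?a n * c s i) \<longlonglongrightarrow> c s i" for s i
      using tendsto_mult[OF one tendsto_const, of "c s i"] by simp
    moreover have "(\<lambda>s i. ?a n * c s i) \<in> cons_set E t" for n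
      using c by (intro cons_set_scale) (auto simp: affordable_def)
    ultimately show "(\<lambda>n. util E h (\<lambda>s i. ?a n * c s i)) \<longlonglongrightarrow> util E h c"
      using c by (intro util_limit[OF h]) (auto simp: affordable_def)
    show "\<exists>N. \<forall>n\<ge>N. util E h (\<lambda>s i. ?a n * c s i) \<le> util E h d"
      using scaled[OF c] by auto
  qed
  then have "is_arg_max (util E h) (\<lambda>c. c \<in> affordable E t h qm q) d"
    using aff by (force simp: is_arg_max_def not_less)
  then show ?thesis
    using allocation_optimal[OF h pm(2) p(2)] unique_optimum[OF h pm(2) p(2)] by blast
qed

text \<open>Compactness and uniqueness: demanded bundles stay bounded because the limit prices are
  positive, and every limit of a subsequence is an optimum at the limit prices, of which there is
  only one.\<close>

lemma tendsto_allocation: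
  assumes h: "h \<in> gen E t" and pm: "\<And>n. 0 \<le> pm n" "0 \<le> qm"
    and p: "\<And>n. positive_prices E (lifespan t) (p n)" "positive_prices E (lifespan t) q"
    and pmlim: "pm \<longlonglongrightarrow> qm"
    and plim: "\<And>s i. s \<in> lifespan t \<Longrightarrow> i \<in> goods E s \<Longrightarrow> (\<lambda>n. p n s i) \<longlonglongrightarrow> q s i"
  shows "(\<lambda>n. allocation E (pm n) (p n) h s i) \<longlonglongrightarrow> allocation E qm q h s i"
proof -
  let ?x = "\<lambda>n. allocation E (pm n) (p n) h"
  have xn: "?x n \<in> cons_set E t" for n
    by (rule allocation_in_cons_set[OF h pm(1) p(1)])
  have "(\<lambda>n. wealth E t h (pm n) (p n)) \<longlonglongrightarrow> wealth E t h qm q"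
    unfolding wealth_def by (intro tendsto_add tendsto_expenditure plim)
      (auto intro: tendsto_mult_right pmlim)
  then have wB: "Bseq (\<lambda>n. wealth E t h (pm n) (p n))"
    using convergentI convergent_imp_Bseq by blast
  have "\<exists>B. \<forall>n. ?x n s i \<le> B" for s i
  proof (cases "s \<in> lifespan t \<and> i \<in> goods E s")
    case True
    obtain W where W: "\<And>n. \<bar>wealth E t h (pm n) (p n)\<bar> \<le> W"
      using wB by (auto simp: Bseq_def)
    have "(\<lambda>n. inverse (p n s i)) \<longlonglongrightarrow> inverse (q s i)"
    proof (intro tendsto_inverse plim)
      show "q s i \<noteq> 0" using True p(2) unfolding positive_prices_def by force
    qed (use True in auto)
    then obtain Q where Q: "\<And>n. \<bar>inverse (p n s i)\<bar> \<le> Q"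
      using convergent_imp_Bseq[OF convergentI] by (fastforce simp: Bseq_def)
    have "?x n s i \<le> W * Q" for n
    proof -
      have pp: "0 < p n s i" using True p(1)[of n] by (simp add: positive_prices_def)
      have "p n s i * ?x n s i \<le> wealth E t h (pm n) (p n)"
        using True p(1)[of n] xn[of n] budget_binding[OF h pm(1) p(1), of n]
        by (intro expenditure_le_imp_coordinate_le) (auto simp: positive_prices_def order_less_imp_le)
      also have "\<dots> \<le> W" using W[of n] by simp
      finally have "?x n s i \<le> W * inverse (p n s i)" using pp by (simp add: field_simps)
      also have "\<dots> \<le> W * Q" using Q[of n] W[of n] pp by (intro mult_left_mono) auto
      finally show ?thesis .
    qed
    then show ?thesis by blast
  next
    case False
    then have "?x n s i = 0" for n using xn[of n] by (auto simp: cons_set_def)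
    then show ?thesis by auto
  qed
  then obtain B where B: "\<And>n s i. ?x n s i \<le> B s i" by metis
  have box: "?x n s i \<in> {0..B s i}" for n s i
    using B[of n s i] xn[of n] by (simp add: cons_set_def)
  show ?thesis
  proof (rule ccontr)
    assume "\<not> (\<lambda>n. ?x n s i) \<longlonglongrightarrow> allocation E qm q h s i"
    then obtain \<epsilon> where "0 < \<epsilon>" and far: "\<forall>N. \<exists>n\<ge>N. \<epsilon> \<le> dist (?x n s i) (allocation E qm q h s i)"
      unfolding lim_sequentially by (force simp: not_less)
    have "infinite {n. \<epsilon> \<le> dist (?x n s i) (allocation E qm q h s i)}"
      unfolding infinite_nat_iff_unbounded_le using far by simp
    then obtain r :: "nat \<Rightarrow> nat" where r: "strict_mono r" "\<forall>n. \<epsilon> \<le> dist (?x (r n) s i) (allocation E qm q h s i)"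
      using infinite_enumerate[of "{n. \<epsilon> \<le> dist (?x n s i) (allocation E qm q h s i)}"] by auto
    obtain d and r' :: "nat \<Rightarrow> nat" where r': "strict_mono r'" and dlim: "\<And>s i. (\<lambda>n. ?x (r (r' n)) s i) \<longlonglongrightarrow> d s i"
    proof (rule bounded_vector_subsequence[of "\<lambda>n. ?x (r n)" "\<lambda>_ _. 0" B])
      show "?x (r n) s i \<in> {0..B s i}" for n s i by (rule box)
    qed (rule that, assumption+)
    have sub: "(\<lambda>n. f (r (r' n))) \<longlonglongrightarrow> a" if "f \<longlonglongrightarrow> a" for f :: "nat \<Rightarrow> real" and a
      using LIMSEQ_subseq_LIMSEQ[OF LIMSEQ_subseq_LIMSEQ[OF that r(1)] r'] by (simp add: o_def)
    have "d = allocation E qm q h"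
      by (rule limit_of_optima_optimal[OF h, of "\<lambda>n. pm (r (r' n))" qm "\<lambda>n. p (r (r' n))"])
        (use pm p sub[OF pmlim] sub[OF plim] dlim in auto)
    then have "(\<lambda>n. ?x (r (r' n)) s i) \<longlonglongrightarrow> allocation E qm q h s i" using dlim by simp
    then have "\<forall>\<^sub>F n in sequentially. dist (?x (r (r' n)) s i) (allocation E qm q h s i) < \<epsilon>"
      using \<open>0 < \<epsilon>\<close> by (rule tendstoD)
    then obtain n where "dist (?x (r (r' n)) s i) (allocation E qm q h s i) < \<epsilon>"
      by (auto simp: eventually_sequentially)
    then show False using r(2) by (simp add: not_less[symmetric])
  qed
qed

end

section \<open>Truncated economies\<close>

definition young_endow :: "'h olg \<Rightarrow> nat \<Rightarrow> real" where
  "young_endow E t = (\<Sum>h\<in>gen E t. norm_at E t (endow E h))"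

definition old_endow :: "'h olg \<Rightarrow> nat \<Rightarrow> real" where
  "old_endow E t = (\<Sum>h\<in>gen E (t - 1). norm_at E t (endow E h))"

text \<open>The value of the net trade of generation \<open>t\<close> in period \<open>s\<close>.
  For \<open>s = t \<ge> 1\<close> it is minus the total saving of the generation, for
  \<open>s = t + 1\<close> what the generation spends out of its saving.\<close>

definition net_spending :: "'h olg \<Rightarrow> real \<Rightarrow> commodity_vector \<Rightarrow> nat \<Rightarrow> nat \<Rightarrow> real" where
  "net_spending E pm p t s =
     (\<Sum>i\<in>goods E s. p s i * (\<Sum>h\<in>gen E t. allocation E pm p h s i - endow E h s i))"

text \<open>After generation \<open>j\<close>, money is a claim to \<open>\<mu> * young_endow E (j + 1)\<close> units of every
  commodity of period \<open>j + 1\<close>, hence its price.\<close>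

definition truncated_supply :: "'h olg \<Rightarrow> nat \<Rightarrow> real \<Rightarrow> nat \<Rightarrow> nat \<Rightarrow> real" where
  "truncated_supply E j \<mu> s i = (\<Sum>h\<in>gen E (s - 1). endow E h s i) +
     (if s \<le> j then \<Sum>h\<in>gen E s. endow E h s i else \<mu> * young_endow E s)"

definition truncated_demand :: "'h olg \<Rightarrow> nat \<Rightarrow> real \<Rightarrow> commodity_vector \<Rightarrow> nat \<Rightarrow> nat \<Rightarrow> real" where
  "truncated_demand E j pm p s i = (\<Sum>h\<in>gen E (s - 1). allocation E pm p h s i) +
     (if s \<le> j then \<Sum>h\<in>gen E s. allocation E pm p h s i else 0)"

text \<open>Making the price of money a function of commodity prices removes it from the unknowns of
  the complementarity problem.\<close>

definition money_price :: "'h olg \<Rightarrow> nat \<Rightarrow> real \<Rightarrow> commodity_vector \<Rightarrow> real" where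
  "money_price E j \<mu> p = \<mu> * young_endow E (j + 1) * norm_at E (j + 1) p"

definition truncated_excess :: "'h olg \<Rightarrow> nat \<Rightarrow> real \<Rightarrow> commodity_vector \<Rightarrow> nat \<Rightarrow> nat \<Rightarrow> real" where
  "truncated_excess E j \<mu> p s i =
     truncated_demand E j (money_price E j \<mu> p) p s i - truncated_supply E j \<mu> s i"

lemma norm_at_nonneg: "(\<And>i. 0 \<le> c s i) \<Longrightarrow> norm_at E s c = (\<Sum>i\<in>goods E s. c s i)"
  by (simp add: norm_at_def)

lemma norm_at_positive_prices:
  "positive_prices E T p \<Longrightarrow> s \<in> T \<Longrightarrow> norm_at E s p = (\<Sum>i\<in>goods E s. p s i)"
  unfolding norm_at_def positive_prices_def by (intro sum.cong refl abs_of_pos) blast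

lemma norm_life_eq:
  "1 \<le> t \<Longrightarrow> norm_life E t c = norm_at E t c + norm_at E (t + 1) c"
  by (simp add: norm_life_def lifespan_def)

lemma positive_prices_mono: "positive_prices E T p \<Longrightarrow> S \<subseteq> T \<Longrightarrow> positive_prices E S p"
  unfolding positive_prices_def by blast

lemma lifespan_subset: "t \<le> j \<Longrightarrow> lifespan t \<subseteq> {1..j + 1}"
  by (auto simp: lifespan_def)

text \<open>The box of period \<open>t\<close> compares all prices of periods \<open>t\<close> and
  \<open>t + 1\<close> with \<open>p t 1\<close>. Chaining along the first commodities from period 1
  costs \<open>t - 1\<close> factors \<open>r\<close>, and one more leads to commodity
  \<open>i\<close>.\<close>

lemma price_ratio_bounds:
  assumes box: "\<And>t. t \<in> {1..j} \<Longrightarrow> normalize_prices t p \<in> price_box E t (\<sigma> t)"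
    and \<sigma>: "\<And>t. t \<in> {1..j} \<Longrightarrow> r \<le> \<sigma> t" and r: "0 < r" "r < 1"
    and pos: "\<And>t. t \<in> {1..j + 1} \<Longrightarrow> 0 < p t 1"
    and goods: "\<And>t. t \<in> {1..j + 1} \<Longrightarrow> 1 \<in> goods E t" and "1 \<le> j"
    and t: "t \<in> {1..j + 1}" "i \<in> goods E t"
  shows "r ^ t * p 1 1 \<le> p t i" "r ^ t * p t i \<le> p 1 1"
proof -
  have step: "r * p t 1 \<le> p s i \<and> r * p s i \<le> p t 1"
    if "t \<in> {1..j}" "s \<in> {t, t + 1}" "i \<in> goods E s" for t s i
  proof -
    have p: "0 < p t 1" using that(1) by (intro pos) auto
    have b: "\<sigma> t \<le> p s i / p t 1" "p s i / p t 1 \<le> inverse (\<sigma> t)"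
      using box[OF that(1)] that(2,3) unfolding price_box_def normalize_prices_def by blast+
    have s: "0 < \<sigma> t" "r \<le> \<sigma> t" using \<sigma>[OF that(1)] r by auto
    have "\<sigma> t * p t 1 \<le> p s i" "\<sigma> t * p s i \<le> p t 1"
      using b p s by (simp_all add: field_simps)
    moreover have "r * p t 1 \<le> \<sigma> t * p t 1" using s p by simp
    moreover have "0 < p s i"
      using calculation p r s by (smt (verit) mult_pos_pos)
    then have "r * p s i \<le> \<sigma> t * p s i" using s by simp
    ultimately show ?thesis by linarith
  qed
  have first: "r ^ n * p 1 1 \<le> p (Suc n) 1 \<and> r ^ n * p (Suc n) 1 \<le> p 1 1" if "n \<le> j" for n
    using that
  proof (induction n)
    case 0
    then show ?case by simp
  next
    case (Suc n)
    then have "Suc n \<in> {1..j}" "1 \<in> goods E (Suc (Suc n))" using goods by auto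
    then have st: "r * p (Suc n) 1 \<le> p (Suc (Suc n)) 1" "r * p (Suc (Suc n)) 1 \<le> p (Suc n) 1"
      using step[of "Suc n" "Suc (Suc n)" 1] by auto
    have IH: "r ^ n * p 1 1 \<le> p (Suc n) 1" "r ^ n * p (Suc n) 1 \<le> p 1 1" using Suc by auto
    have "r * (r ^ n * p 1 1) \<le> r * p (Suc n) 1" using IH r by (intro mult_left_mono) auto
    moreover have "r ^ n * (r * p (Suc (Suc n)) 1) \<le> r ^ n * p (Suc n) 1"
      using st r by (intro mult_left_mono) auto
    ultimately show ?case using st IH by (simp add: ac_simps)
  qed
  have main: "r ^ Suc n * p 1 1 \<le> p s i \<and> r ^ Suc n * p s i \<le> p 1 1"
    if n: "n < j" and s: "s \<in> {Suc n, Suc n + 1}" "i \<in> goods E s" for n s i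
  proof -
    have st: "r * p (Suc n) 1 \<le> p s i" "r * p s i \<le> p (Suc n) 1"
      using step[of "Suc n" s i] n s by auto
    have f: "r ^ n * p 1 1 \<le> p (Suc n) 1" "r ^ n * p (Suc n) 1 \<le> p 1 1"
      using first[of n] n by auto
    have "r * (r ^ n * p 1 1) \<le> r * p (Suc n) 1" using f r by (intro mult_left_mono) auto
    moreover have "r ^ n * (r * p s i) \<le> r ^ n * p (Suc n) 1"
      using st r by (intro mult_left_mono) auto
    ultimately show ?thesis using st f by (simp add: ac_simps)
  qed
  have "r ^ t * p 1 1 \<le> p t i \<and> r ^ t * p t i \<le> p 1 1"
  proof (cases "t \<le> j")
    case True
    moreover obtain n where "t = Suc n" using t by (cases t) auto
    ultimately show ?thesis using main[of n t i] t by simp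
  next
    case False
    \<comment> \<open>Period \<open>j + 1\<close> has no box of its own. It is reached through the
      box of period \<open>j\<close> with exponent \<open>j\<close>, which is then weakened.\<close>
    then have tj: "t = Suc j" using t by auto
    moreover obtain n where n: "j = Suc n" using \<open>1 \<le> j\<close> by (cases j) auto
    ultimately have m: "r ^ j * p 1 1 \<le> p t i" "r ^ j * p t i \<le> p 1 1"
      using main[of n t i] t by simp_all
    have "0 < p 1 1" using pos by simp
    moreover have "0 < p t i"
      using m(1) \<open>0 < p 1 1\<close> r by (smt (verit) mult_pos_pos zero_less_power)
    moreover have "r ^ t \<le> r ^ j" using tj r by (intro power_decreasing) auto
    ultimately have "r ^ t * p 1 1 \<le> r ^ j * p 1 1" "r ^ t * p t i \<le> r ^ j * p t i" by auto
    then show ?thesis using m by linarith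
  qed
  then show "r ^ t * p 1 1 \<le> p t i" "r ^ t * p t i \<le> p 1 1" by auto
qed

section \<open>Walras' law with redemption of money\<close>

context olg
begin

lemma norm_at_endow: "h \<in> gen E t \<Longrightarrow> norm_at E s (endow E h) = (\<Sum>i\<in>goods E s. endow E h s i)"
  by (intro norm_at_nonneg endow_nonneg)

lemma young_endow_eq: "young_endow E s = (\<Sum>i\<in>goods E s. \<Sum>h\<in>gen E s. endow E h s i)"
  unfolding young_endow_def by (subst sum.swap) (simp add: norm_at_endow)

lemma old_endow_eq: "old_endow E s = (\<Sum>i\<in>goods E s. \<Sum>h\<in>gen E (s - 1). endow E h s i)"
  unfolding old_endow_def by (subst sum.swap) (simp add: norm_at_endow)

lemma young_endow_nonneg: "0 \<le> young_endow E s"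
  unfolding young_endow_eq by (intro sum_nonneg endow_nonneg)

lemma net_spending_eq:
  "(\<Sum>s\<in>lifespan t. net_spending E pm p t s) =
    (\<Sum>h\<in>gen E t. expenditure E t p (allocation E pm p h) - expenditure E t p (endow E h))"
proof -
  have "net_spending E pm p t s = (\<Sum>h\<in>gen E t. (\<Sum>i\<in>goods E s. p s i * allocation E pm p h s i) -
      (\<Sum>i\<in>goods E s. p s i * endow E h s i))" for s
    unfolding net_spending_def sum_distrib_left
    by (subst sum.swap) (simp add: right_diff_distrib sum_subtractf)
  then show ?thesis
    unfolding expenditure_def sum_subtractf[symmetric]
    by (simp only:) (rule sum.swap)
qed

lemma net_spending_gen0:
  assumes "0 \<le> pm" "positive_prices E {1} p"
  shows "net_spending E pm p 0 1 = pm"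
proof -
  have p: "positive_prices E (lifespan 0) p" using assms by (simp add: lifespan_def)
  have "net_spending E pm p 0 1 = (\<Sum>s\<in>lifespan 0. net_spending E pm p 0 s)"
    by (simp add: lifespan_def)
  also have "\<dots> = (\<Sum>h\<in>gen E 0. pm * money E h)"
    unfolding net_spending_eq
    by (intro sum.cong) (simp_all add: budget_binding[OF _ assms(1) p] wealth_def)
  also have "\<dots> = pm" by (simp flip: sum_distrib_left add: sum_money)
  finally show ?thesis .
qed

lemma net_spending_young:
  assumes "1 \<le> t" "0 \<le> pm" "positive_prices E {t, t + 1} p"
  shows "net_spending E pm p t t + net_spending E pm p t (t + 1) = 0"
proof -
  have p: "positive_prices E (lifespan t) p" using assms by (simp add: lifespan_def)
  have "net_spending E pm p t t + net_spending E pm p t (t + 1) =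
      (\<Sum>s\<in>lifespan t. net_spending E pm p t s)"
    using assms by (simp add: lifespan_def)
  also have "\<dots> = 0"
    unfolding net_spending_eq using assms(1)
    by (intro sum.neutral) (simp add: budget_binding[OF _ assms(2) p] wealth_def)
  finally show ?thesis .
qed

text \<open>Each generation born in \<open>1..n\<close> has net spending 0 over its life, so only
  the money spent by generation 0 survives. The extra term is the second period of generation
  \<open>n\<close>, which the sum does not reach.\<close>

lemma net_spending_telescope:
  assumes "0 \<le> pm" "positive_prices E {1..n + 1} p"
  shows "(\<Sum>s=1..n. net_spending E pm p (s - 1) s + net_spending E pm p s s) +
    net_spending E pm p n (n + 1) = pm"
  using assms(2)
proof (induction n)
  case 0
  then show ?case using net_spending_gen0[OF assms(1), of p] by simp
next
  case (Suc n)
  have "positive_prices E {1..n + 1} p" "positive_prices E {Suc n, Suc n + 1} p"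
    using Suc.prems by (auto elim: positive_prices_mono)
  then show ?case
    using Suc.IH net_spending_young[of "Suc n" pm p] assms(1) by simp
qed

text \<open>Aggregate spending exceeds the value of endowments by the money of generation 0, and the
  redemption bundle added to the supply of period \<open>j + 1\<close> has exactly this
  value.\<close>

lemma truncated_walras:
  assumes "0 \<le> money_price E j \<mu> p" and p: "positive_prices E {1..j + 1} p"
  shows "(\<Sum>s=1..j + 1. \<Sum>i\<in>goods E s. p s i * truncated_excess E j \<mu> p s i) = 0"
proof -
  let ?pm = "money_price E j \<mu> p"
  have early: "(\<Sum>i\<in>goods E s. p s i * truncated_excess E j \<mu> p s i) =
      net_spending E ?pm p (s - 1) s + net_spending E ?pm p s s" if "s \<in> {1..j}" for s
    using that unfolding net_spending_def truncated_excess_def truncated_demand_def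
      truncated_supply_def sum.distrib[symmetric]
    by (intro sum.cong) (simp_all add: sum_subtractf algebra_simps)
  have "?pm = (\<Sum>i\<in>goods E (j + 1). p (j + 1) i * (\<mu> * young_endow E (j + 1)))"
    unfolding money_price_def using norm_at_positive_prices[OF p, of "j + 1"]
    by (simp add: sum_distrib_left sum_distrib_right mult.commute)
  then have last: "(\<Sum>i\<in>goods E (j + 1). p (j + 1) i * truncated_excess E j \<mu> p (j + 1) i) =
      net_spending E ?pm p j (j + 1) - ?pm"
    unfolding net_spending_def truncated_excess_def truncated_demand_def truncated_supply_def
    by (simp add: sum_subtractf right_diff_distrib distrib_left sum.distrib)
  show ?thesis
    using net_spending_telescope[OF assms] early last by simp
qed

end

section \<open>Available resources and the border condition\<close>

locale growing_olg = olg E for E :: "'h olg" +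
  fixes \<alpha>min \<alpha>max \<beta> :: real and \<sigma> :: "nat \<Rightarrow> real" and r :: real
  assumes \<alpha>min: "0 < \<alpha>min"
    and growth: "bounded_intraperiod_growth E \<alpha>min \<alpha>max"
    and \<beta>: "\<beta> = max (1 + inverse \<alpha>min) (1 + \<alpha>max)"
    and border: "unbounded_demand_at_border E \<beta> \<sigma>"
    and r: "0 < r" "r < 1" "\<And>t. 1 \<le> t \<Longrightarrow> r \<le> \<sigma> t"
begin

text \<open>This explains both entries of \<beta>: \<open>1 + inverse \<alpha>min\<close> bounds the
  resources of a period relative to the endowment of the young, and \<open>1 + \<alpha>max\<close>
  relative to that of the old.\<close>

lemma growth_bounds:
  assumes "1 \<le> t"
  shows old_endow_pos: "0 < old_endow E t" and young_endow_pos: "0 < young_endow E t"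
    and young_resources: "old_endow E t + young_endow E t < \<beta> * young_endow E t"
    and old_resources: "old_endow E t + young_endow E t < \<beta> * old_endow E t"
proof -
  have "young_endow E (t - 1 + 1) / old_endow E (t - 1 + 1) \<in> {\<alpha>min<..<\<alpha>max}"
    using growth unfolding bounded_intraperiod_growth_def young_endow_def old_endow_def by simp
  then have ratio: "\<alpha>min < young_endow E t / old_endow E t" "young_endow E t / old_endow E t < \<alpha>max"
    using assms by auto
  have "0 \<le> old_endow E t"
    unfolding old_endow_eq by (intro sum_nonneg endow_nonneg)
  moreover have "old_endow E t \<noteq> 0" using ratio \<alpha>min by (intro notI) simp
  ultimately show old: "0 < old_endow E t" by simp
  then have lt: "\<alpha>min * old_endow E t < young_endow E t" "young_endow E t < \<alpha>max * old_endow E t"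
    using ratio by (simp_all add: field_simps)
  have "0 < \<alpha>min * old_endow E t" using \<alpha>min old by simp
  then show young: "0 < young_endow E t" using lt by linarith
  have "old_endow E t < inverse \<alpha>min * young_endow E t" using lt(1) \<alpha>min by (simp add: field_simps)
  moreover have "(1 + inverse \<alpha>min) * young_endow E t \<le> \<beta> * young_endow E t"
    using young \<beta> by (intro mult_right_mono) auto
  ultimately show "old_endow E t + young_endow E t < \<beta> * young_endow E t"
    by (simp add: distrib_right)
  have "(1 + \<alpha>max) * old_endow E t \<le> \<beta> * old_endow E t"
    using old \<beta> by (intro mult_right_mono) auto
  then show "old_endow E t + young_endow E t < \<beta> * old_endow E t"
    using lt(2) by (simp add: distrib_right)
qed

text \<open>The redemption bundle has norm \<open>\<mu> * num_goods E (j + 1)\<close> times the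
  endowment of the absent young. The condition on \<mu> keeps it within that endowment, so the
  growth bounds remain usable in the last period.\<close>

lemma sum_truncated_supply_le:
  assumes "s \<in> {1..j + 1}" "\<mu> * real (num_goods E (j + 1)) \<le> 1"
  shows "(\<Sum>i\<in>goods E s. truncated_supply E j \<mu> s i) \<le> old_endow E s + young_endow E s"
proof (cases "s \<le> j")
  case True
  then show ?thesis
    by (simp add: truncated_supply_def sum.distrib old_endow_eq young_endow_eq)
next
  case False
  then have s: "s = j + 1" using assms by auto
  have "(\<Sum>i\<in>goods E s. truncated_supply E j \<mu> s i) =
      old_endow E s + (\<mu> * real (num_goods E (j + 1))) * young_endow E s"
    using s by (simp add: truncated_supply_def sum.distrib old_endow_eq goods_def)
  also have "\<dots> \<le> old_endow E s + 1 * young_endow E s"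
    using assms(2) young_endow_nonneg by (intro add_left_mono mult_right_mono) auto
  finally show ?thesis by simp
qed

text \<open>The margin of the border argument: \<beta> times the endowment of generation
  \<open>t\<close>, less everything available in the two periods of its life.\<close>

definition slack :: "nat \<Rightarrow> real" where
  "slack t = \<beta> * (young_endow E t + old_endow E (t + 1)) -
     (old_endow E t + young_endow E t + old_endow E (t + 1) + young_endow E (t + 1))"

lemma slack_pos: "1 \<le> t \<Longrightarrow> 0 < slack t"
  using young_resources[of t] old_resources[of "t + 1"] by (simp add: slack_def distrib_left)

text \<open>Outside the box generation \<open>t\<close> would demand more than \<beta> times its
  endowment, while its demand is at most the supply of its two periods plus \<epsilon> per
  commodity. The tolerance \<epsilon> is there because the boxes are needed before markets are known
  to clear.\<close>

lemma prices_in_box: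
  assumes t: "t \<in> {1..j}" and \<mu>: "\<mu> * real (num_goods E (j + 1)) \<le> 1"
    and p: "positive_prices E {1..j + 1} p" and pm: "0 \<le> pm"
    and excess: "\<And>s i. s \<in> {1..j + 1} \<Longrightarrow> i \<in> goods E s \<Longrightarrow>
      truncated_demand E j pm p s i - truncated_supply E j \<mu> s i \<le> \<epsilon>"
    and \<epsilon>: "\<epsilon> * (real (num_goods E t) + real (num_goods E (t + 1))) \<le> slack t"
  shows "normalize_prices t p \<in> price_box E t (\<sigma> t)"
proof (rule ccontr)
  assume "normalize_prices t p \<notin> price_box E t (\<sigma> t)"
  moreover have pt: "positive_prices E {t, t + 1} p"
    by (rule positive_prices_mono[OF p]) (use t in auto)
  ultimately have big: "(\<Sum>h\<in>gen E t. norm_life E t (demand E t h p)) >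
      \<beta> * (\<Sum>h\<in>gen E t. norm_life E t (endow E h))"
    using border t unfolding unbounded_demand_at_border_def by auto
  have eq: "(\<Sum>h\<in>gen E t. norm_life E t (demand E t h p)) =
      (\<Sum>h\<in>gen E t. norm_life E t (allocation E pm p h))"
    using t by (intro sum.cong refl) (simp add: allocation_young)
  have le: "(\<Sum>h\<in>gen E t. norm_at E s (allocation E pm p h)) \<le>
      old_endow E s + young_endow E s + \<epsilon> * real (num_goods E s)" if s: "s \<in> {t, t + 1}" for s
  proof -
    have x: "0 \<le> allocation E pm p h s i" if "h \<in> gen E k" "k \<le> j" for h k i
      by (rule allocation_nonneg[OF that(1) pm positive_prices_mono[OF p lifespan_subset[OF that(2)]]])
    have sj: "s \<in> {1..j + 1}" using s t by auto
    have "(\<Sum>h\<in>gen E t. norm_at E s (allocation E pm p h)) =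
        (\<Sum>i\<in>goods E s. \<Sum>h\<in>gen E t. allocation E pm p h s i)"
      using t by (subst sum.swap) (intro sum.cong norm_at_nonneg refl x, auto)
    also have "\<dots> \<le> (\<Sum>i\<in>goods E s. truncated_demand E j pm p s i)"
    proof (intro sum_mono)
      fix i
      have "0 \<le> (\<Sum>h\<in>gen E (s - 1). allocation E pm p h s i)"
        using sj by (intro sum_nonneg x) auto
      moreover have "s \<le> j \<Longrightarrow> 0 \<le> (\<Sum>h\<in>gen E s. allocation E pm p h s i)"
        by (intro sum_nonneg x) auto
      ultimately show "(\<Sum>h\<in>gen E t. allocation E pm p h s i) \<le> truncated_demand E j pm p s i"
        using s t by (auto simp: truncated_demand_def)
    qed
    also have "\<dots> \<le> (\<Sum>i\<in>goods E s. truncated_supply E j \<mu> s i + \<epsilon>)"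
      using excess[OF sj] by (intro sum_mono) (simp add: algebra_simps)
    also have "\<dots> = (\<Sum>i\<in>goods E s. truncated_supply E j \<mu> s i) + \<epsilon> * real (num_goods E s)"
      by (simp add: sum.distrib goods_def)
    finally show ?thesis using sum_truncated_supply_le[OF sj \<mu>] by linarith
  qed
  show False
    using big eq le[of t] le[of "t + 1"] \<epsilon> t
    by (simp add: norm_life_eq sum.distrib young_endow_def old_endow_def slack_def algebra_simps)
qed

lemma truncated_supply_nonneg:
  assumes "0 \<le> \<mu>"
  shows "0 \<le> truncated_supply E j \<mu> s i"
proof -
  have "0 \<le> (\<Sum>h\<in>gen E k. endow E h s i)" for k by (intro sum_nonneg endow_nonneg)
  moreover have "0 \<le> \<mu> * young_endow E s" using assms young_endow_nonneg by simp
  ultimately show ?thesis by (simp add: truncated_supply_def)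
qed

lemma money_price_pos:
  assumes "0 < \<mu>" "positive_prices E {1..j + 1} p"
  shows "0 < money_price E j \<mu> p"
proof -
  have "0 < norm_at E (j + 1) p"
    using assms(2) goods_nonempty[of "j + 1"]
    by (subst norm_at_positive_prices[of E "{1..j + 1}"])
      (auto simp: positive_prices_def intro!: sum_pos)
  then show ?thesis
    using assms(1) young_endow_pos[of "j + 1"] by (simp add: money_price_def)
qed

lemma truncated_excess_ge:
  assumes "0 < \<mu>" "positive_prices E {1..j + 1} p" "s \<in> {1..j + 1}"
  shows "- truncated_supply E j \<mu> s i \<le> truncated_excess E j \<mu> p s i"
proof -
  have "0 \<le> allocation E (money_price E j \<mu> p) p h s i" if "h \<in> gen E k" "k \<le> j" for h k
    by (rule allocation_nonneg[OF that(1) _ positive_prices_mono[OF assms(2) lifespan_subset[OF that(2)]]])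
      (use money_price_pos[OF assms(1,2)] in simp)
  then have nonneg: "0 \<le> (\<Sum>h\<in>gen E k. allocation E (money_price E j \<mu> p) p h s i)" if "k \<le> j" for k
    using that by (intro sum_nonneg)
  show ?thesis
    using nonneg[of "s - 1"] nonneg[of s] assms(3) by (auto simp: truncated_excess_def truncated_demand_def)
qed

lemma tendsto_truncated_excess:
  assumes \<mu>: "0 < \<mu>" and p: "\<And>n. positive_prices E {1..j + 1} (p n)" "positive_prices E {1..j + 1} q"
    and lim: "\<And>s i. s \<in> {1..j + 1} \<Longrightarrow> i \<in> goods E s \<Longrightarrow> (\<lambda>n. p n s i) \<longlonglongrightarrow> q s i"
    and s: "s \<in> {1..j + 1}"
  shows "(\<lambda>n. truncated_excess E j \<mu> (p n) s i) \<longlonglongrightarrow> truncated_excess E j \<mu> q s i"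
proof -
  have pm: "(\<lambda>n. money_price E j \<mu> (p n)) \<longlonglongrightarrow> money_price E j \<mu> q"
    unfolding money_price_def norm_at_def
    by (intro tendsto_mult tendsto_const tendsto_sum tendsto_rabs lim) auto
  have "(\<lambda>n. allocation E (money_price E j \<mu> (p n)) (p n) h s i) \<longlonglongrightarrow>
      allocation E (money_price E j \<mu> q) q h s i" if h: "h \<in> gen E k" "k \<le> j" for h k
  proof (rule tendsto_allocation[OF h(1) _ _ _ _ pm])
    note sub = lifespan_subset[OF h(2)]
    show "0 \<le> money_price E j \<mu> (p n)" "0 \<le> money_price E j \<mu> q" for n
      using money_price_pos[OF \<mu> p(1)] money_price_pos[OF \<mu> p(2)] by (simp_all add: less_imp_le)
    show "positive_prices E (lifespan k) (p n)" "positive_prices E (lifespan k) q" for n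
      using positive_prices_mono[OF p(1) sub] positive_prices_mono[OF p(2) sub] by auto
    show "(\<lambda>n. p n s i) \<longlonglongrightarrow> q s i" if "s \<in> lifespan k" "i \<in> goods E s" for s i
      using that sub by (intro lim) auto
  qed
  then have sums: "(\<lambda>n. \<Sum>h\<in>gen E k. allocation E (money_price E j \<mu> (p n)) (p n) h s i) \<longlonglongrightarrow>
      (\<Sum>h\<in>gen E k. allocation E (money_price E j \<mu> q) q h s i)" if "k \<le> j" for k
    using that by (intro tendsto_sum)
  show ?thesis
  proof (cases "s \<le> j")
    case True
    then show ?thesis
      unfolding truncated_excess_def truncated_demand_def
      by (simp only: if_True) (intro tendsto_diff tendsto_add tendsto_const sums, auto)
  next
    case False
    then show ?thesis using s
      unfolding truncated_excess_def truncated_demand_def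
      by (simp only: if_False) (intro tendsto_diff tendsto_add tendsto_const sums, auto)
  qed
qed

end

section \<open>Existence of equilibria in the truncated economies\<close>

context growing_olg
begin

lemma truncated_equilibrium:
  assumes \<mu>: "0 < \<mu>" "\<mu> * real (num_goods E (j + 1)) \<le> 1" and j: "1 \<le> j"
  obtains p where "positive_prices E {1..j + 1} p"
    "\<And>s i. s \<in> {1..j + 1} \<Longrightarrow> i \<in> goods E s \<Longrightarrow> truncated_excess E j \<mu> p s i = 0"
proof -
  define I where "I = Sigma {1..j + 1} (goods E)"
  define res where "res k = truncated_supply E j \<mu> (fst k) (snd k)" for k
  define R where "R = (\<Sum>k\<in>I. res k)"
  \<comment> \<open>A lower bound for the ratio of any two prices: one factor
    \<open>r ^ (j + 1)\<close> for each of the two comparisons with the first price of period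
    1.\<close>
  define \<kappa> where "\<kappa> = r ^ (j + 1) * r ^ (j + 1)"
  define L where "L t = real (num_goods E t) + real (num_goods E (t + 1))" for t
  have finI: "finite I" by (simp add: I_def)
  have res: "0 \<le> res k" for k
    unfolding res_def using \<mu> by (intro truncated_supply_nonneg) auto
  have rj: "0 < r ^ (j + 1)" "r ^ (j + 1) < 1"
    using r power_Suc_less_one[of r j] by auto
  have "r ^ (j + 1) * r ^ (j + 1) < 1 * 1"
    using rj by (intro mult_strict_mono) auto
  then have \<kappa>: "0 < \<kappa>" "\<kappa> < 1"
    using rj by (simp_all add: \<kappa>_def)
  \<comment> \<open>\<open>\<eta> * R\<close> will bound every excess demand. It has to fit into the
    slack of the finitely many generations involved, in addition to
    \<open>\<eta> < \<kappa>\<close>.\<close>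
  have small: "\<forall>\<^sub>F \<eta> in at_right 0. \<eta> * R * L t < slack t" if "t \<in> {1..j}" for t
  proof -
    have "((\<lambda>\<eta>. \<eta> * R * L t) \<longlongrightarrow> 0 * R * L t) (at_right 0)"
      by (intro tendsto_intros)
    then show ?thesis
      using slack_pos[of t] that by (intro order_tendstoD(2)) auto
  qed
  have "\<forall>\<^sub>F \<eta> in at_right 0. \<eta> \<in> {0<..<\<kappa>} \<and> (\<forall>t\<in>{1..j}. \<eta> * R * L t < slack t)"
    using small \<kappa>(1) by (intro eventually_conj eventually_at_right_real eventually_ball_finite) auto
  then have "\<exists>\<eta>. \<eta> \<in> {0<..<\<kappa>} \<and> (\<forall>t\<in>{1..j}. \<eta> * R * L t < slack t)"
    by (rule eventually_happens'[OF trivial_limit_at_right_real])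
  then obtain \<eta> where \<eta>: "0 < \<eta>" "\<eta> < \<kappa>" "\<And>t. t \<in> {1..j} \<Longrightarrow> \<eta> * R * L t < slack t"
    by auto
  define P where "P x = (\<lambda>s i. x (s, i))" for x :: "nat \<times> nat \<Rightarrow> real"
  have pos: "positive_prices E {1..j + 1} (P x)" if "\<And>k. k \<in> I \<Longrightarrow> x k \<in> {\<eta>..1}" for x
    unfolding positive_prices_def
  proof (intro ballI)
    fix s i assume "s \<in> {1..j + 1}" "i \<in> goods E s"
    then have "(s, i) \<in> I" by (simp add: I_def)
    from that[OF this] show "0 < P x s i" using \<eta> by (simp add: P_def)
  qed
  obtain x where x: "\<And>k. k \<in> I \<Longrightarrow> x k \<in> {\<eta>..1}"
    and upper: "\<And>k. k \<in> I \<Longrightarrow> x k < 1 \<Longrightarrow> truncated_excess E j \<mu> (P x) (fst k) (snd k) \<le> 0"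
    and lower: "\<And>k. k \<in> I \<Longrightarrow> \<eta> < x k \<Longrightarrow> 0 \<le> truncated_excess E j \<mu> (P x) (fst k) (snd k)"
  proof (rule box_complementarity[of I \<eta> 1 "\<lambda>x k. truncated_excess E j \<mu> (P x) (fst k) (snd k)"])
    show "finite I" by (rule finI)
    show "\<eta> < 1" using \<eta> \<kappa> by simp
    fix X :: "nat \<Rightarrow> nat \<times> nat \<Rightarrow> real" and x k
    assume k: "k \<in> I" and X: "\<And>n k. k \<in> I \<Longrightarrow> X n k \<in> {\<eta>..1}"
      and x: "\<And>k. k \<in> I \<Longrightarrow> x k \<in> {\<eta>..1}"
      and lim: "\<And>k. k \<in> I \<Longrightarrow> (\<lambda>n. X n k) \<longlonglongrightarrow> x k"
    show "(\<lambda>n. truncated_excess E j \<mu> (P (X n)) (fst k) (snd k)) \<longlonglongrightarrow>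
        truncated_excess E j \<mu> (P x) (fst k) (snd k)"
    proof (rule tendsto_truncated_excess[OF \<mu>(1)])
      show "positive_prices E {1..j + 1} (P (X n))" for n by (rule pos[OF X])
      show "positive_prices E {1..j + 1} (P x)" by (rule pos[OF x])
      show "(\<lambda>n. P (X n) s i) \<longlonglongrightarrow> P x s i" if "s \<in> {1..j + 1}" "i \<in> goods E s" for s i
        unfolding P_def using that by (intro lim) (simp add: I_def)
      show "fst k \<in> {1..j + 1}" using k by (auto simp: I_def)
    qed
  qed (rule that, assumption+)
  define z where "z k = truncated_excess E j \<mu> (P x) (fst k) (snd k)" for k
  have p: "positive_prices E {1..j + 1} (P x)"
    by (rule pos) (rule x)
  have pm: "0 \<le> money_price E j \<mu> (P x)"
    by (rule less_imp_le[OF money_price_pos[OF \<mu>(1) p]])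
  have walras: "(\<Sum>k\<in>I. x k * z k) = 0"
    using truncated_walras[OF pm p]
    unfolding I_def P_def z_def by (subst (asm) sum.Sigma) (simp_all add: case_prod_unfold)
  have z_ge: "- res k \<le> z k" if "k \<in> I" for k
    unfolding z_def res_def using that
    by (intro truncated_excess_ge[OF \<mu>(1) p]) (auto simp: I_def)
  \<comment> \<open>positive excess demand occurs only at price \<open>1\<close> and is paid for by excess supply at price \<open>\<eta>\<close>\<close>
  have z_le: "z k \<le> \<eta> * R" if k: "k \<in> I" for k
  proof (cases "x k < 1")
    case True
    then have "z k \<le> 0" using upper[OF k] by (simp add: z_def)
    also have "0 \<le> \<eta> * R"
      using \<eta> res by (simp add: R_def sum_nonneg)
    finally show ?thesis .
  next
    case False
    then have "x k = 1" using x[OF k] by simp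
    then have "z k = - (\<Sum>l\<in>I - {k}. x l * z l)"
      using walras sum.remove[OF finI k, of "\<lambda>l. x l * z l"] by simp
    also have "\<dots> = (\<Sum>l\<in>I - {k}. - (x l * z l))" by (simp add: sum_negf)
    also have "\<dots> \<le> (\<Sum>l\<in>I - {k}. \<eta> * res l)"
    proof (intro sum_mono)
      fix l assume "l \<in> I - {k}"
      then have l: "l \<in> I" by simp
      show "- (x l * z l) \<le> \<eta> * res l"
      proof (cases "\<eta> < x l")
        case True
        then have "0 \<le> x l * z l" using lower[OF l] \<eta> by (simp add: z_def)
        also have "0 \<le> \<eta> * res l" using \<eta> res by simp
        ultimately show ?thesis by linarith
      next
        case False
        then have "x l = \<eta>" using x[OF l] by simp
        moreover have "\<eta> * (- z l) \<le> \<eta> * res l"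
          using z_ge[OF l] \<eta> by (intro mult_left_mono) auto
        ultimately show ?thesis by simp
      qed
    qed
    also have "\<dots> \<le> (\<Sum>l\<in>I. \<eta> * res l)"
      using finI \<eta> res by (intro sum_mono2) auto
    also have "\<dots> = \<eta> * R" by (simp add: R_def sum_distrib_left)
    finally show ?thesis .
  qed
  have box: "normalize_prices t (P x) \<in> price_box E t (\<sigma> t)" if t: "t \<in> {1..j}" for t
  proof (rule prices_in_box[OF t \<mu>(2) p pm, of "\<eta> * R"])
    show "truncated_demand E j (money_price E j \<mu> (P x)) (P x) s i - truncated_supply E j \<mu> s i \<le> \<eta> * R"
      if "s \<in> {1..j + 1}" "i \<in> goods E s" for s i
      using z_le[of "(s, i)"] that by (simp add: z_def truncated_excess_def I_def)
    show "\<eta> * R * (real (num_goods E t) + real (num_goods E (t + 1))) \<le> slack t"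
      using \<eta>(3)[OF t] by (simp add: L_def)
  qed
  have comparable: "\<kappa> * x l \<le> x k" if kl: "k \<in> I" "l \<in> I" for k l
  proof -
    have pos1: "0 < P x t 1" if "t \<in> {1..j + 1}" for t
      using p goods_nonempty[of t] that unfolding positive_prices_def by auto
    have ratio: "r ^ fst k * P x 1 1 \<le> x k" "r ^ fst k * x k \<le> P x 1 1" if "k \<in> I" for k
      using price_ratio_bounds[of j "P x" E \<sigma> r "fst k" "snd k"] box r pos1 goods_nonempty j that
      by (auto simp: P_def I_def)
    have "r ^ (j + 1) \<le> r ^ fst k" if "k \<in> I" for k
      using that r by (intro power_decreasing) (auto simp: I_def)
    moreover have "0 \<le> x l" "0 \<le> P x 1 1" using x[OF kl(2)] pos1[of 1] \<eta> by auto
    ultimately have "r ^ (j + 1) * P x 1 1 \<le> x k" "r ^ (j + 1) * x l \<le> P x 1 1"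
      using ratio kl by (meson mult_right_mono order_trans)+
    moreover have "r ^ (j + 1) * (r ^ (j + 1) * x l) \<le> r ^ (j + 1) * P x 1 1"
      using calculation r by (intro mult_left_mono) auto
    ultimately show ?thesis by (simp add: \<kappa>_def mult.assoc)
  qed
  have xpos: "0 < x k" if "k \<in> I" for k using x[OF that] \<eta> by auto
  \<comment> \<open>If some price is at the floor \<eta>, then \<open>\<eta> < \<kappa>\<close>
    keeps all prices below the cap and no excess demand is positive; otherwise none is negative. In
    both cases Walras' law is a vanishing sum of terms of one sign, with positive prices as
    weights.\<close>
  have zero: "z k = 0" if k: "k \<in> I" for k
  proof (cases "\<exists>l\<in>I. x l = \<eta>")
    case True
    have "0 \<le> - (x m * z m)" if m: "m \<in> I" for m
    proof -
      obtain l where "l \<in> I" "x l = \<eta>" using True by blast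
      then have "\<kappa> * x m < \<kappa> * 1"
        using comparable[of l m] m \<eta>(2) by linarith
      then have "x m < 1"
        using \<kappa>(1) by (rule mult_left_less_imp_less[OF _ less_imp_le])
      then have "z m \<le> 0" using upper[OF m] by (simp add: z_def)
      then show ?thesis using xpos[OF m] by (simp add: mult_le_0_iff)
    qed
    moreover have "(\<Sum>m\<in>I. - (x m * z m)) = 0" using walras by (simp add: sum_negf)
    ultimately have "- (x k * z k) = 0"
      using sum_nonneg_eq_0_iff[OF finI, of "\<lambda>m. - (x m * z m)"] k by blast
    then show ?thesis using xpos[OF k] by simp
  next
    case False
    have "0 \<le> x m * z m" if m: "m \<in> I" for m
    proof -
      have "\<eta> < x m" using x[OF m] False m by force
      then show ?thesis using lower[OF m] xpos[OF m] by (simp add: z_def)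
    qed
    then have "x k * z k = 0"
      using sum_nonneg_eq_0_iff[OF finI, of "\<lambda>m. x m * z m"] k walras by blast
    then show ?thesis using xpos[OF k] by simp
  qed
  show ?thesis
  proof (rule that[OF p])
    show "truncated_excess E j \<mu> (P x) s i = 0" if "s \<in> {1..j + 1}" "i \<in> goods E s" for s i
      using zero[of "(s, i)"] that by (simp add: z_def I_def)
  qed
qed

end

section \<open>Savings rates and uniform price bounds\<close>

context olg
begin

text \<open>If all earlier markets clear, the telescoping sum leaves the old of period
  \<open>t\<close> spending the whole money stock. Clearing in period \<open>t\<close> then forces
  the young to take it over.\<close>

lemma net_spending_market_clearing:
  assumes pm: "0 \<le> pm" and p: "positive_prices E {1..j + 1} p"
    and clear: "\<And>s i. s \<in> {1..j} \<Longrightarrow> i \<in> goods E s \<Longrightarrow>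
      aggregate E (allocation E pm p) s i = aggregate E (endow E) s i"
    and t: "t \<in> {1..j}"
  shows "net_spending E pm p t t = - pm"
proof -
  have zero: "net_spending E pm p (s - 1) s + net_spending E pm p s s = 0" if s: "s \<in> {1..j}" for s
  proof -
    have "net_spending E pm p (s - 1) s + net_spending E pm p s s =
        (\<Sum>i\<in>goods E s. p s i * (aggregate E (allocation E pm p) s i - aggregate E (endow E) s i))"
      unfolding net_spending_def aggregate_def sum.distrib[symmetric]
      by (intro sum.cong refl) (simp add: sum_subtractf algebra_simps)
    also have "\<dots> = 0" using clear[OF s] by simp
    finally show ?thesis .
  qed
  obtain n where n: "t = Suc n" using t by (cases t) auto
  have "positive_prices E {1..n + 1} p" by (rule positive_prices_mono[OF p]) (use t n in auto)
  from net_spending_telescope[OF pm this] have "net_spending E pm p n (n + 1) = pm"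
    using zero t n by simp
  then show ?thesis using zero[OF t] n by simp
qed

text \<open>The price of money \<open>pm\<close> is arbitrary, since demand of generations
  \<open>t \<ge> 1\<close> does not depend on it.\<close>

lemma sum_savings:
  assumes "1 \<le> t"
  shows "(\<Sum>h\<in>gen E t. savings E t h p) = - net_spending E pm p t t / norm_at E t p"
proof -
  have "(\<Sum>h\<in>gen E t. savings E t h p) =
      (\<Sum>i\<in>goods E t. \<Sum>h\<in>gen E t. p t i / norm_at E t p * (endow E h t i - allocation E pm p h t i))"
    unfolding savings_def using assms
    by (subst sum.swap) (intro sum.cong refl, simp add: allocation_young)
  also have "\<dots> = (\<Sum>i\<in>goods E t. - (p t i * (\<Sum>h\<in>gen E t. allocation E pm p h t i - endow E h t i)) / norm_at E t p)"
    by (intro sum.cong refl, subst sum_distrib_left[symmetric])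
      (simp add: sum_subtractf algebra_simps diff_divide_distrib)
  also have "\<dots> = - net_spending E pm p t t / norm_at E t p"
    by (simp add: net_spending_def sum_negf flip: sum_divide_distrib)
  finally show ?thesis .
qed

lemma norm_at_pos:
  assumes "1 \<le> s" "positive_prices E T p" "s \<in> T"
  shows "0 < norm_at E s p"
  using assms(2,3) goods_nonempty[OF assms(1)]
  by (subst norm_at_positive_prices[OF assms(2,3)]) (auto simp: positive_prices_def intro!: sum_pos)

end

text \<open>Turns the price inequality of proneness to savings into growth, by the factor
  \<open>k\<close>, of price norm times endowment norm of the young.\<close>

lemma cross_multiply_growth:
  fixes a b c d k :: real
  assumes "0 < b" "0 < c" "0 < k" "a / b \<le> 1 / k * (d / c)"
  shows "k * (a * c) \<le> b * d"
proof -
  have "a / b * (b * (k * c)) \<le> 1 / k * (d / c) * (b * (k * c))"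
    using assms by (intro mult_right_mono) auto
  moreover have "a / b * (b * (k * c)) = k * (a * c)" "1 / k * (d / c) * (b * (k * c)) = b * d"
    using assms by auto
  ultimately show ?thesis by simp
qed

context growing_olg
begin

text \<open>Clearing is retained only up to period \<open>j\<close>, because the market of period
  \<open>j + 1\<close> contains the redemption bundle in place of the young. What is kept of that
  period is the value of the bundle.\<close>

lemma normalized_truncated_equilibrium:
  assumes \<mu>: "0 < \<mu>" "\<mu> * real (num_goods E (j + 1)) \<le> 1" and j: "1 \<le> j"
  obtains q where "positive_prices E {1..j + 1} q"
    "\<And>s i. s \<in> {1..j} \<Longrightarrow> i \<in> goods E s \<Longrightarrow>
      aggregate E (allocation E 1 q) s i = aggregate E (endow E) s i"
    "money_price E j \<mu> q = 1"
    "\<And>t. t \<in> {1..j} \<Longrightarrow> normalize_prices t q \<in> price_box E t (\<sigma> t)"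
proof -
  obtain p where p: "positive_prices E {1..j + 1} p"
    and z: "\<And>s i. s \<in> {1..j + 1} \<Longrightarrow> i \<in> goods E s \<Longrightarrow> truncated_excess E j \<mu> p s i = 0"
    by (rule truncated_equilibrium[OF assms]) (rule that, assumption+)
  define pm where "pm = money_price E j \<mu> p"
  have pm: "0 < pm" unfolding pm_def by (rule money_price_pos[OF \<mu>(1) p])
  define q where "q = (\<lambda>s i. p s i / pm)"
  show ?thesis
  proof (rule that[of q])
    show "positive_prices E {1..j + 1} q"
      using p pm by (simp add: positive_prices_def q_def)
    have "norm_at E (j + 1) q = norm_at E (j + 1) p / pm"
      using pm by (simp add: norm_at_def q_def sum_divide_distrib abs_of_pos)
    then have "money_price E j \<mu> q = money_price E j \<mu> p / pm"
      by (simp only: money_price_def times_divide_eq_right)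
    then show "money_price E j \<mu> q = 1"
      using pm by (simp flip: pm_def)
    show "aggregate E (allocation E 1 q) s i = aggregate E (endow E) s i"
      if "s \<in> {1..j}" "i \<in> goods E s" for s i
    proof -
      have "(\<Sum>h\<in>gen E k. allocation E 1 q h s i) = (\<Sum>h\<in>gen E k. allocation E pm p h s i)" for k
        unfolding q_def by (intro sum.cong refl) (simp add: allocation_homogeneous[OF _ pm])
      then show ?thesis
        using z[of s i] that
        by (simp add: truncated_excess_def truncated_demand_def truncated_supply_def aggregate_def
            flip: pm_def)
    qed
    show "normalize_prices t q \<in> price_box E t (\<sigma> t)" if t: "t \<in> {1..j}" for t
    proof -
      have "normalize_prices t q = normalize_prices t p"
        using pm by (simp add: normalize_prices_def q_def)
      moreover have "normalize_prices t p \<in> price_box E t (\<sigma> t)"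
      \<comment> \<open>Markets now clear exactly, so the tolerance is 0.\<close>
      proof (rule prices_in_box[OF t \<mu>(2) p less_imp_le[OF pm], of 0])
        show "truncated_demand E j pm p s i - truncated_supply E j \<mu> s i \<le> 0"
          if "s \<in> {1..j + 1}" "i \<in> goods E s" for s i
          using z[OF that] by (simp add: truncated_excess_def pm_def)
        show "0 * (real (num_goods E t) + real (num_goods E (t + 1))) \<le> slack t"
          using slack_pos[of t] t by simp
      qed
      ultimately show ?thesis by simp
    qed
  qed
qed

text \<open>Where the savings rate is at most \<open>\<delta>\<close> the value of the endowments grows, so the savings
  rate stays below \<open>\<mu>\<close> once it is there; but in the last period it equals \<open>\<mu>\<close>.\<close>

lemma truncated_savings_bound:
  assumes \<epsilon>: "0 < \<epsilon>" and \<mu>: "0 < \<mu>" "\<mu> \<le> \<delta>"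
    and prone: "\<And>t p. 1 \<le> t \<Longrightarrow> positive_prices E {t, t + 1} p \<Longrightarrow>
      normalize_prices t p \<in> price_box E t (\<sigma> t) \<Longrightarrow>
      (\<Sum>h\<in>gen E t. savings E t h p) / young_endow E t \<le> \<delta> \<Longrightarrow>
      norm_at E t p / norm_at E (t + 1) p \<le>
        1 / (1 + \<epsilon>) * (young_endow E (t + 1) / young_endow E t)"
    and q: "positive_prices E {1..j + 1} q"
    and clear: "\<And>s i. s \<in> {1..j} \<Longrightarrow> i \<in> goods E s \<Longrightarrow>
      aggregate E (allocation E 1 q) s i = aggregate E (endow E) s i"
    and last: "money_price E j \<mu> q = 1"
    and box: "\<And>t. t \<in> {1..j} \<Longrightarrow> normalize_prices t q \<in> price_box E t (\<sigma> t)"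
    and t: "1 \<le> t" "t \<le> j + 1"
  shows "\<mu> * young_endow E t * norm_at E t q \<le> 1"
  using t(2)
\<comment> \<open>The induction runs backwards from period \<open>j + 1\<close>, where redemption
  makes the bound an equality.\<close>
proof (induction rule: inc_induct)
  case base
  then show ?case using last by (simp add: money_price_def)
next
  case (step n)
  then have n: "n \<in> {1..j}" using t by auto
  have pos: "0 < young_endow E n" "0 < young_endow E (n + 1)" "0 < norm_at E n q" "0 < norm_at E (n + 1) q"
    using n young_endow_pos norm_at_pos[OF _ q] by auto
  show ?case
  proof (rule ccontr)
    assume "\<not> \<mu> * young_endow E n * norm_at E n q \<le> 1"
    \<comment> \<open>A failure means that the savings rate is below
      \<open>\<mu> \<le> \<delta>\<close>. Proneness to savings then makes price norm times
      endowment norm at least as large in the next period, against the induction hypothesis.\<close>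
    then have big: "1 < \<mu> * young_endow E n * norm_at E n q" by simp
    have "(\<Sum>h\<in>gen E n. savings E n h q) = 1 / norm_at E n q"
      using sum_savings[of n q 1] net_spending_market_clearing[OF _ q clear n] n by simp
    moreover have "1 / norm_at E n q / young_endow E n \<le> \<mu>"
      using big pos by (simp add: field_simps)
    ultimately have "(\<Sum>h\<in>gen E n. savings E n h q) / young_endow E n \<le> \<mu>"
      by (simp only:)
    then have "norm_at E n q / norm_at E (n + 1) q \<le>
        1 / (1 + \<epsilon>) * (young_endow E (n + 1) / young_endow E n)"
      using n \<mu> q box[OF n] by (intro prone positive_prices_mono[OF q]) auto
    then have "(1 + \<epsilon>) * (norm_at E n q * young_endow E n) \<le> norm_at E (n + 1) q * young_endow E (n + 1)"
      using pos \<epsilon> by (intro cross_multiply_growth) auto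
    moreover have "norm_at E n q * young_endow E n \<le> (1 + \<epsilon>) * (norm_at E n q * young_endow E n)"
      using pos \<epsilon> by simp
    ultimately have "\<mu> * (norm_at E n q * young_endow E n) \<le> \<mu> * (norm_at E (n + 1) q * young_endow E (n + 1))"
      using \<mu> by (intro mult_left_mono) auto
    then show False using big step.IH by (simp add: ac_simps)
  qed
qed

text \<open>When the first market clears, generation 0 consumes at most the resources of period 1,
  which are below \<beta> times its endowment. The price of money is 1 as in the condition on
  generation 0.\<close>

lemma first_price_ge:
  assumes old: "\<And>p. positive_prices E {1} p \<Longrightarrow> (MIN i\<in>goods E 1. p 1 i) < lam \<Longrightarrow>
      (\<Sum>h\<in>gen E 0. norm_at E 1 (demand_old E h 1 p)) > \<beta> * (\<Sum>h\<in>gen E 0. norm_at E 1 (endow E h))"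
    and q: "positive_prices E {1, 2} q"
    and clear: "\<And>i. i \<in> goods E 1 \<Longrightarrow>
      aggregate E (allocation E 1 q) 1 i = aggregate E (endow E) 1 i"
    and i: "i \<in> goods E 1"
  shows "lam \<le> q 1 i"
proof -
  have q1: "positive_prices E {1} q" by (rule positive_prices_mono[OF q]) auto
  have x: "0 \<le> allocation E 1 q h 1 i" if "h \<in> gen E k" "k \<le> 1" for h k i
    by (rule allocation_nonneg[OF that(1) _ positive_prices_mono[OF q]])
      (use that in \<open>auto simp: lifespan_def\<close>)
  have "(\<Sum>h\<in>gen E 0. norm_at E 1 (demand_old E h 1 q)) =
      (\<Sum>h\<in>gen E 0. \<Sum>i\<in>goods E 1. allocation E 1 q h 1 i)"
    by (intro sum.cong refl) (simp add: norm_at_def x[of _ 0, simplified] flip: allocation_old)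
  also have "\<dots> = (\<Sum>i\<in>goods E 1. \<Sum>h\<in>gen E 0. allocation E 1 q h 1 i)"
    by (rule sum.swap)
  also have "\<dots> \<le> (\<Sum>i\<in>goods E 1. aggregate E (allocation E 1 q) 1 i)"
    using x[of _ 1] by (intro sum_mono) (simp add: aggregate_def sum_nonneg)
  also have "\<dots> = old_endow E 1 + young_endow E 1"
    using clear by (subst sum.cong[OF refl clear])
      (simp_all add: aggregate_def sum.distrib old_endow_eq young_endow_eq)
  also have "\<dots> < \<beta> * (\<Sum>h\<in>gen E 0. norm_at E 1 (endow E h))"
    using old_resources[of 1] by (simp add: old_endow_def)
  finally have "\<not> (MIN i\<in>goods E 1. q 1 i) < lam"
    using old[OF q1] by fastforce
  moreover have "(MIN i\<in>goods E 1. q 1 i) \<le> q 1 i"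
    using i by (intro Min_le) auto
  ultimately show ?thesis by simp
qed

end

section \<open>Passage to the limit\<close>

theorem theorem6:
  fixes E :: "'h olg" and \<alpha>min \<alpha>max \<beta> lam :: real and \<sigma> :: "nat \<Rightarrow> real"
  assumes "olg_economy E"
    and "0 < \<alpha>min" and "\<alpha>min < \<alpha>max"
    and "bounded_intraperiod_growth E \<alpha>min \<alpha>max"
    and "\<beta> = max (1 + inverse \<alpha>min) (1 + \<alpha>max)"
    and "\<And>j h' h''. h' \<in> born_upto E j \<Longrightarrow> h'' \<in> born_upto E j \<Longrightarrow> h' \<noteq> h'' \<Longrightarrow>
           indirectly_resource_related E j h' h''"
    and "generalized_cass_criterion E"
    and "unbounded_demand_at_border E \<beta> \<sigma>"
    and "prone_to_savings E \<sigma>"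
    and "(INF t\<in>{1..}. \<sigma> t) > 0"
    and "bdd_above (num_goods E ` {1..})"
    and "lam > 0"
    and "\<And>p. positive_prices E {1} p \<Longrightarrow> (MIN i\<in>goods E 1. p 1 i) < lam \<Longrightarrow>
           (\<Sum>h\<in>gen E 0. norm_at E 1 (demand_old E h 1 p)) >
           \<beta> * (\<Sum>h\<in>gen E 0. norm_at E 1 (endow E h))"
  shows "\<exists>pm p. equilibrium E pm p \<and> monetary pm p \<and> pareto_optimal E pm p"
proof -
  define r where "r = (INF t\<in>{1..}. \<sigma> t)"
  have \<sigma>: "0 < \<sigma> t" "\<sigma> t < 1" if "1 \<le> t" for t
    using assms(8) that unfolding unbounded_demand_at_border_def by auto
  then have "bdd_below (\<sigma> ` {1..})"
    by (intro bdd_belowI2[of _ 0]) (simp add: less_imp_le)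
  then have r_le: "r \<le> \<sigma> t" if "1 \<le> t" for t
    unfolding r_def using that by (intro cINF_lower) auto
  have r: "0 < r" "r < 1"
    using assms(10) r_le[of 1] \<sigma>[of 1] by (auto simp: r_def)
  interpret growing_olg E \<alpha>min \<alpha>max \<beta> \<sigma> r
    using assms(1,2,4,5,8) r r_le by unfold_locales
  obtain \<epsilon> \<delta> where \<epsilon>: "0 < \<epsilon>" and \<delta>: "0 < \<delta>"
    and prone: "\<And>t p. 1 \<le> t \<Longrightarrow> positive_prices E {t, t + 1} p \<Longrightarrow>
      normalize_prices t p \<in> price_box E t (\<sigma> t) \<Longrightarrow>
      (\<Sum>h\<in>gen E t. savings E t h p) / young_endow E t \<le> \<delta> \<Longrightarrow>
      norm_at E t p / norm_at E (t + 1) p \<le>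
        1 / (1 + \<epsilon>) * (young_endow E (t + 1) / young_endow E t)"
    using assms(9) unfolding prone_to_savings_def young_endow_def by blast
  obtain B where B: "num_goods E t \<le> B" if "1 \<le> t" for t
    using assms(11) by (auto simp: bdd_above_def)
  \<comment> \<open>The bound \<delta> serves the savings induction; the other one, with
    \<open>B\<close> bounding all numbers of commodities, keeps every redemption bundle within the
    endowment it replaces.\<close>
  define \<mu> where "\<mu> = min \<delta> (1 / (1 + real B))"
  have \<mu>: "0 < \<mu>" "\<mu> \<le> \<delta>" using \<delta> by (auto simp: \<mu>_def)
  have \<mu>B: "\<mu> * real (num_goods E (j + 1)) \<le> 1" for j
  proof -
    have "\<mu> * real (num_goods E (j + 1)) \<le> 1 / (1 + real B) * (1 + real B)"
      using B[of "j + 1"] \<mu> by (intro mult_mono) (auto simp: \<mu>_def)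
    then show ?thesis by simp
  qed
  \<comment> \<open>\<open>lo\<close> combines the bound \<open>lam\<close> on the first price with
    the chain of price ratios, and \<open>hi\<close> comes from the lower bound \<mu> on savings
    rates. The maximum in \<open>hi\<close> makes \<open>lo s\<close> an admissible default
    value.\<close>
  define lo where "lo s = r ^ s * lam" for s
  define hi where "hi s = max (lo s) (1 / (\<mu> * young_endow E s))" for s
  have lo: "0 < lo s" for s using r assms(12) by (simp add: lo_def)
  define approx where "approx n q \<longleftrightarrow> (\<forall>s i. q s i \<in> {lo s..hi s}) \<and>
    (\<forall>s\<in>{1..Suc n}. \<forall>i\<in>goods E s. aggregate E (allocation E 1 q) s i = aggregate E (endow E) s i) \<and>
    (\<forall>s\<in>{1..Suc n}. \<mu> * young_endow E s * norm_at E s q \<le> 1)" for n q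
  have "\<exists>q. approx n q" for n
  proof -
    define j where "j = Suc n"
    have j: "1 \<le> j" by (simp add: j_def)
    obtain q where q: "positive_prices E {1..j + 1} q"
      and clear: "\<And>s i. s \<in> {1..j} \<Longrightarrow> i \<in> goods E s \<Longrightarrow>
        aggregate E (allocation E 1 q) s i = aggregate E (endow E) s i"
      and last: "money_price E j \<mu> q = 1"
      and box: "\<And>t. t \<in> {1..j} \<Longrightarrow> normalize_prices t q \<in> price_box E t (\<sigma> t)"
      by (rule normalized_truncated_equilibrium[OF \<mu>(1) \<mu>B j]) (rule that, assumption+)
    have bound: "\<mu> * young_endow E t * norm_at E t q \<le> 1" if "1 \<le> t" "t \<le> j + 1" for t
      by (rule truncated_savings_bound[OF \<epsilon> \<mu>, of j q t]) (fact prone q clear last box that)+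
    have "lam \<le> q 1 1"
    proof (rule first_price_ge[of lam q 1])
      show "\<beta> * (\<Sum>h\<in>gen E 0. norm_at E 1 (endow E h)) <
          (\<Sum>h\<in>gen E 0. norm_at E 1 (demand_old E h 1 p))"
        if "positive_prices E {1} p" "(MIN i\<in>goods E 1. p 1 i) < lam" for p
        using that by (rule assms(13))
      show "positive_prices E {1, 2} q" by (rule positive_prices_mono[OF q]) (use j in auto)
      show "aggregate E (allocation E 1 q) 1 i = aggregate E (endow E) 1 i" if "i \<in> goods E 1" for i
        using j that by (intro clear) auto
      show "1 \<in> goods E 1" by (rule goods_nonempty) simp
    qed
    have q_pos: "0 < q s i" if "s \<in> {1..j + 1}" "i \<in> goods E s" for s i
      using q that unfolding positive_prices_def by blast
    have q_lo: "lo s \<le> q s i" if "s \<in> {1..j + 1}" "i \<in> goods E s" for s i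
    proof -
      have "r ^ s * lam \<le> r ^ s * q 1 1"
        using \<open>lam \<le> q 1 1\<close> r by (intro mult_left_mono) auto
      also have "\<dots> \<le> q s i"
        by (rule price_ratio_bounds(1)[of j q E \<sigma> r])
          (use box r r_le q_pos goods_nonempty j that in auto)
      finally show ?thesis by (simp add: lo_def)
    qed
    have q_hi: "q s i \<le> hi s" if s: "s \<in> {1..j + 1}" and i: "i \<in> goods E s" for s i
    proof -
      have y: "0 < young_endow E s" using s by (intro young_endow_pos) auto
      have "q s i \<le> norm_at E s q"
        unfolding norm_at_positive_prices[OF q s]
        using i q_pos[OF s] by (intro member_le_sum) (auto intro: less_imp_le)
      also have "\<dots> \<le> 1 / (\<mu> * young_endow E s)"
        using bound[of s] s y \<mu> by (simp add: field_simps)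
      finally show ?thesis by (simp add: hi_def)
    qed
    \<comment> \<open>Coordinates beyond the horizon or the commodities get the default
      \<open>lo s\<close>, so that all approximations lie in one product of intervals. Demand of
      generations up to \<open>j\<close> is not affected.\<close>
    define q' where "q' s i = (if s \<in> {1..j + 1} \<and> i \<in> goods E s then q s i else lo s)" for s i
    have "approx n q'"
      unfolding approx_def
    proof (intro conjI allI ballI)
      show "q' s i \<in> {lo s..hi s}" for s i
        using q_lo[of s i] q_hi[of s i] by (auto simp: q'_def hi_def)
      fix s assume s: "s \<in> {1..Suc n}"
      have "norm_at E s q' = norm_at E s q"
        unfolding norm_at_def using s by (intro sum.cong refl) (simp add: q'_def j_def)
      then show "\<mu> * young_endow E s * norm_at E s q' \<le> 1"
        using bound[of s] s by (simp add: j_def)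
      have "allocation E 1 q' h = allocation E 1 q h" if h: "h \<in> gen E k" "k \<le> j" for h k
      proof (rule allocation_cong[OF h(1)])
        fix s i assume "s \<in> lifespan k" "i \<in> goods E s"
        then show "q' s i = q s i" using lifespan_subset[OF h(2)] by (auto simp: q'_def)
      qed
      then have "aggregate E (allocation E 1 q') s i = aggregate E (allocation E 1 q) s i" for i
        unfolding aggregate_def using s by (intro arg_cong2[of _ _ _ _ "(+)"] sum.cong refl) (auto simp: j_def)
      then show "aggregate E (allocation E 1 q') s i = aggregate E (endow E) s i"
        if "i \<in> goods E s" for i
        using clear[OF _ that] s by (simp add: j_def)
    qed
    then show ?thesis by (rule exI[of "approx n" q'])
  qed
  moreover define X where "X n = (SOME q. approx n q)" for n
  ultimately have "approx n (X n)" for n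
    by (simp add: someI_ex)
  then have X: "X n s i \<in> {lo s..hi s}"
    "s \<in> {1..Suc n} \<Longrightarrow> i \<in> goods E s \<Longrightarrow>
      aggregate E (allocation E 1 (X n)) s i = aggregate E (endow E) s i"
    "s \<in> {1..Suc n} \<Longrightarrow> \<mu> * young_endow E s * norm_at E s (X n) \<le> 1" for n s i
    unfolding approx_def by blast+
  obtain p and \<rho> :: "nat \<Rightarrow> nat" where p: "\<And>s i. p s i \<in> {lo s..hi s}" and \<rho>: "strict_mono \<rho>"
    and lim: "\<And>s i. (\<lambda>n. X (\<rho> n) s i) \<longlonglongrightarrow> p s i"
  proof (rule bounded_vector_subsequence[of X "\<lambda>s _. lo s" "\<lambda>s _. hi s"])
    show "X n s i \<in> {lo s..hi s}" for n s i by (rule X(1))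
  qed (rule that, assumption+)
  have pos: "positive_prices E T q" if "\<And>s i. q s i \<in> {lo s..hi s}" for T q
    unfolding positive_prices_def
  proof (intro ballI)
    fix s i
    have "lo s \<le> q s i" using that[of s i] by simp
    then show "0 < q s i" using lo[of s] by linarith
  qed
  \<comment> \<open>Since \<open>\<rho> n \<ge> n\<close>, each fixed period lies within the horizon
    of all but finitely many approximations; a market needs only two generations, so clearing passes
    to the limit period by period.\<close>
  have late: "\<forall>\<^sub>F n in sequentially. t \<in> {1..Suc (\<rho> n)}" if "1 \<le> t" for t
    using eventually_ge_at_top[of t]
  proof eventually_elim
    case (elim n)
    then show ?case using that seq_suble[OF \<rho>, of n] by simp
  qed
  have eq: "equilibrium E 1 p"
    unfolding equilibrium_def
  proof (intro conjI allI impI ballI)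
    show "positive_prices E {1..} p" by (rule pos[OF p])
    fix t i assume t: "1 \<le> t" and i: "i \<in> goods E t"
    have "(\<lambda>n. allocation E 1 (X (\<rho> n)) h t i) \<longlonglongrightarrow> allocation E 1 p h t i" if h: "h \<in> gen E k" for h k
      by (rule tendsto_allocation[OF h, of "\<lambda>_. 1"]) (auto intro: pos X(1) p lim)
    then have "(\<lambda>n. aggregate E (allocation E 1 (X (\<rho> n))) t i) \<longlonglongrightarrow> aggregate E (allocation E 1 p) t i"
      unfolding aggregate_def by (intro tendsto_add tendsto_sum)
    moreover have "\<forall>\<^sub>F n in sequentially.
        aggregate E (allocation E 1 (X (\<rho> n))) t i = aggregate E (endow E) t i"
      using late[OF t] by eventually_elim (rule X(2)[OF _ i])
    then have "(\<lambda>n. aggregate E (allocation E 1 (X (\<rho> n))) t i) \<longlonglongrightarrow> aggregate E (endow E) t i"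
      by (rule tendsto_eventually)
    ultimately show "aggregate E (allocation E 1 p) t i = aggregate E (endow E) t i"
      by (rule LIMSEQ_unique)
  qed simp
  have "\<mu> \<le> 1 / (norm_at E t p * (\<Sum>h\<in>gen E t. norm_at E t (endow E h)))" if t: "1 \<le> t" for t
  proof -
    have "(\<lambda>n. \<mu> * young_endow E t * norm_at E t (X (\<rho> n))) \<longlonglongrightarrow> \<mu> * young_endow E t * norm_at E t p"
      unfolding norm_at_def by (intro tendsto_mult tendsto_const tendsto_sum tendsto_rabs lim)
    moreover have "\<forall>\<^sub>F n in sequentially. \<mu> * young_endow E t * norm_at E t (X (\<rho> n)) \<le> 1"
      using late[OF t] by eventually_elim (rule X(3))
    ultimately have "\<mu> * young_endow E t * norm_at E t p \<le> 1"
      by (intro tendsto_upperbound) auto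
    moreover have "0 < norm_at E t p" using norm_at_pos[OF t pos[OF p], of UNIV] by simp
    ultimately show ?thesis
      using young_endow_pos[OF t] by (simp add: field_simps flip: young_endow_def)
  qed
  then have "(\<Sum>t=1..n. \<mu>) \<le> (\<Sum>t=1..n. 1 / (norm_at E t p * (\<Sum>h\<in>gen E t. norm_at E t (endow E h))))" for n
    by (intro sum_mono) auto
  then have sums: "\<mu> * real n \<le> (\<Sum>t=1..n. 1 / (norm_at E t p * (\<Sum>h\<in>gen E t. norm_at E t (endow E h))))" for n
    by (simp add: mult.commute)
  have "filterlim (\<lambda>n. \<mu> * real n) at_top sequentially"
    using \<mu> by (intro filterlim_tendsto_pos_mult_at_top[OF tendsto_const _ filterlim_real_sequentially])
  then have "filterlim (\<lambda>n. \<Sum>t=1..n. 1 / (norm_at E t p * (\<Sum>h\<in>gen E t. norm_at E t (endow E h))))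
      at_top sequentially"
    by (rule filterlim_at_top_mono) (intro always_eventually allI sums)
  then have "pareto_optimal E 1 p"
    using assms(7) eq unfolding generalized_cass_criterion_def by blast
  then show ?thesis
    using eq by (intro exI[of _ 1] exI[of _ p]) (simp add: monetary_def)
qed

end
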